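(* Let $n\ge3$, $p\in(1,2]$, $q>p-1$, $0\le -a<p$, and let $A:\mathbb{R}^n\times\mathbb{R}^n\to\mathbb{R}^n$ satisfy the structure conditions in the context. Assume $n\le p^2$ (that is, $p\in[\sqrt n,2]$). If $u$ is a bounded positive weak solution of $$-\operatorname{div}A(x,\nabla u)=|x|^au^q(x),\qquad u>0\ \text{ in }\mathbb{R}^n,$$ then $u\notin L^p(\mathbb{R}^n)$; in particular $u\notin W^{1,p}(\mathbb{R}^n)$.
   Context: Structure conditions on $A$: $x\mapsto A(x,\xi)$ is measurable for all $\xi\in\mathbb{R}^n$; $\xi\mapsto A(x,\xi)$ is continuous for a.e. $x\in\mathbb{R}^n$; and there are constants $0<\mu_1\le\mu_2<\infty$ such that for a.e. $x$ and all $\xi,\xi_1,\xi_2\in\mathbb{R}^n$: $A(x,\xi)\cdot\xi\ge\mu_1|\xi|^p$; $|A(x,\xi)|\le\mu_2|\xi|^{p-1}$; $[A(x,\xi_1)-A(x,\xi_2)]\cdot(\xi_1-\xi_2)>0$ if $\xi_1\ne\xi_2$; $A(x,\lambda\xi)=\lambda|\lambda|^{p-2}A(x,\xi)$ for all real $\lambda\ne0$. A positive weak solution is a function $u\in W^{1,p}_{loc}(\mathbb{R}^n)\cap C(\mathbb{R}^n)$, $u>0$, with $\int_{\mathbb{R}^n}A(x,\nabla u)\cdot\nabla\zeta\,dx=\int_{\mathbb{R}^n}|x|^au^q\zeta\,dx$ for all $\zeta\in C_0^\infty(\mathbb{R}^n)$. *)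

theory Defs
  imports "HOL-Analysis.Analysis"
begin

(* Powers with real exponents are written with powr. Recall that 0 powr s = 0 for every
   s; this only differs from the usual convention for s <= 0, which concerns the weight
   norm x powr a at the single (null) point x = 0. *)

definition Lp :: "real \<Rightarrow> ('a::euclidean_space \<Rightarrow> 'b::euclidean_space) set" where
  "Lp p = {f. f \<in> borel_measurable lebesgue \<and> integrable lebesgue (\<lambda>x. norm (f x) powr p)}"

definition Lp_loc :: "real \<Rightarrow> ('a::euclidean_space \<Rightarrow> 'b::euclidean_space) set" where
  "Lp_loc p = {f. f \<in> borel_measurable lebesgue \<and>
     (\<forall>K. compact K \<longrightarrow> set_integrable lebesgue K (\<lambda>x. norm (f x) powr p))}"

definition partial_deriv :: "'n \<Rightarrow> (real^'n::finite \<Rightarrow> real) \<Rightarrow> real^'n \<Rightarrow> real" where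
  "partial_deriv i f x = frechet_derivative f (at x) (axis i 1)"

definition gradient :: "(real^'n::finite \<Rightarrow> real) \<Rightarrow> real^'n \<Rightarrow> real^'n" where
  "gradient f x = (\<chi> i. partial_deriv i f x)"

primrec k_smooth :: "nat \<Rightarrow> (real^'n::finite \<Rightarrow> real) \<Rightarrow> bool" where
  "k_smooth 0 f \<longleftrightarrow> continuous_on UNIV f"
| "k_smooth (Suc k) f \<longleftrightarrow>
     (\<forall>x. f differentiable (at x)) \<and> (\<forall>i. k_smooth k (partial_deriv i f))"

definition test_functions :: "(real^'n::finite \<Rightarrow> real) set" where
  "test_functions = {\<zeta>. (\<forall>k. k_smooth k \<zeta>) \<and> compact (closure {x. \<zeta> x \<noteq> 0})}"

definition has_weak_gradient :: "(real^'n::finite \<Rightarrow> real) \<Rightarrow> (real^'n \<Rightarrow> real^'n) \<Rightarrow> bool" where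
  "has_weak_gradient u G \<longleftrightarrow> u \<in> Lp_loc 1 \<and> G \<in> Lp_loc 1 \<and>
     (\<forall>\<zeta>\<in>test_functions. \<forall>i.
        (\<integral>x. u x * partial_deriv i \<zeta> x \<partial>lebesgue) = - (\<integral>x. G x $ i * \<zeta> x \<partial>lebesgue))"

definition W1p :: "real \<Rightarrow> (real^'n::finite \<Rightarrow> real) set" where
  "W1p p = {u. u \<in> Lp p \<and> (\<exists>G\<in>Lp p. has_weak_gradient u G)}"

definition W1p_loc :: "real \<Rightarrow> (real^'n::finite \<Rightarrow> real) set" where
  "W1p_loc p = {u. u \<in> Lp_loc p \<and> (\<exists>G\<in>Lp_loc p. has_weak_gradient u G)}"

definition structure_conditions :: "real \<Rightarrow> (real^'n::finite \<Rightarrow> real^'n \<Rightarrow> real^'n) \<Rightarrow> bool" where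
  "structure_conditions p A \<longleftrightarrow>
     (\<forall>\<xi>. (\<lambda>x. A x \<xi>) \<in> borel_measurable lebesgue) \<and>
     (AE x in lebesgue. continuous_on UNIV (A x)) \<and>
     (\<exists>\<mu>1 \<mu>2. 0 < \<mu>1 \<and> \<mu>1 \<le> \<mu>2 \<and>
        (AE x in lebesgue.
           (\<forall>\<xi>. A x \<xi> \<bullet> \<xi> \<ge> \<mu>1 * norm \<xi> powr p) \<and>
           (\<forall>\<xi>. norm (A x \<xi>) \<le> \<mu>2 * norm \<xi> powr (p - 1)) \<and>
           (\<forall>\<xi>1 \<xi>2. \<xi>1 \<noteq> \<xi>2 \<longrightarrow> (A x \<xi>1 - A x \<xi>2) \<bullet> (\<xi>1 - \<xi>2) > 0) \<and>
           (\<forall>\<xi> t. t \<noteq> 0 \<longrightarrow> A x (t *\<^sub>R \<xi>) = (t * \<bar>t\<bar> powr (p - 2)) *\<^sub>R A x \<xi>)))"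

(* The weak gradient is unique up to null sets, so the choice of the representative G
   is immaterial. Under the structure conditions and for p > 1, both
   integrands are integrable whenever norm x powr a is locally integrable. *)

definition positive_weak_solution ::
  "real \<Rightarrow> real \<Rightarrow> real \<Rightarrow> (real^'n::finite \<Rightarrow> real^'n \<Rightarrow> real^'n) \<Rightarrow> (real^'n \<Rightarrow> real) \<Rightarrow> bool" where
  "positive_weak_solution p a q A u \<longleftrightarrow>
     u \<in> W1p_loc p \<and> continuous_on UNIV u \<and> (\<forall>x. u x > 0) \<and>
     (\<exists>G\<in>Lp_loc p. has_weak_gradient u G \<and>
        (\<forall>\<zeta>\<in>test_functions.
           (\<integral>x. A x (G x) \<bullet> gradient \<zeta> x \<partial>lebesgue) =
           (\<integral>x. norm x powr a * u x powr q * \<zeta> x \<partial>lebesgue)))"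

end

theory Submission
  imports Defs
begin

text \<open>
  Write \<open>G\<close> for the weak gradient of \<open>u\<close>, \<open>V x = A x (G x)\<close> for the flux and \<open>w = |G| / u\<close>.
  Testing the equation with \<open>\<eta>\<^sup>2 u^(1-p)\<close>, where \<open>\<eta>\<close> is a cutoff function of the ball of radius \<open>2R\<close>,
  gives the logarithmic energy bound \<open>\<integral> w^p \<le> C R^(n-p)\<close> on that ball. Testing it with a cutoff function
  of the ball of radius \<open>R\<close> shows that the flux through the shell \<open>R \<le> |x| \<le> 2R\<close>, at most
  \<open>(C/R) \<integral> |G|^(p-1)\<close>, stays above a positive constant. Since \<open>|G|^(p-1) = w^(p-1) u^(p-1)\<close>, Young's inequality
  with exponents \<open>(p-1)/p\<close>, \<open>(p-1)/p\<close> and \<open>(2-p)/p\<close> bounds the flux by \<open>R^(n/p-p)\<close> times a constant that is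
  arbitrarily small for large \<open>R\<close> when \<open>u\<close> is in \<open>L^p\<close>; and \<open>n/p - p \<le> 0\<close> is the hypothesis \<open>n \<le> p\<^sup>2\<close>.

  The test function \<open>\<eta>\<^sup>2 u^(1-p)\<close> is reached by mollifying \<open>u\<close>, which keeps it smooth and positive. Dominated
  convergence applies along a subsequence because \<open>|G|^(p-1) |G * \<rho>| \<le> |G|^p + |G|^p * \<rho>\<close>, so that \<open>L^1\<close>
  convergence of mollifications suffices.
\<close>

section \<open>Smooth functions\<close>

text \<open>The hypothesis p \<le> 2 enters twice. The weight must be smooth, so \<eta>^2 takes the
  place of the customary \<eta>^p, and absorbing the cross term then needs \<eta> \<le>
  \<eta>^(p-1), which holds for \<eta> \<le> 1 because p - 1 \<le> 1. Later the third Young exponent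
  (2-p)/p must be nonnegative.

  When n = p^2 the power of R is 0, so letting R grow gains nothing by itself. Smallness comes from
  the tail of the integral of u^p, whose term in Young's inequality is weighted by a parameter t.
  The outcome is c0 * t^\<alpha> \<le> C * (C1 + t * \<epsilon>), where \<alpha> = (p-1)/p and
  \<epsilon> is the tail outside the ball of radius R. At fixed t the radius tends to infinity and
  \<epsilon> disappears; then t grows and the left side becomes unbounded.

  The right-hand side of the equation enters through two facts: it is nonnegative, and its integral
  over the unit ball is positive.

  The estimates are carried out for Borel representatives with \<open>lborel\<close>, so that
  Tonelli's theorem and compositions raise no measurability questions.\<close>

lemma has_derivative_gradient:
  fixes f :: "real^'n::finite \<Rightarrow> real"
  assumes "f differentiable (at x)"
  shows "(f has_derivative (\<lambda>h. gradient f x \<bullet> h)) (at x)"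
proof -
  let ?D = "frechet_derivative f (at x)"
  have D: "(f has_derivative ?D) (at x)"
    using assms frechet_derivative_works by blast
  then have lin: "linear ?D"
    by (rule has_derivative_linear)
  have "?D h = gradient f x \<bullet> h" for h
  proof -
    have "?D h = ?D (\<Sum>i\<in>UNIV. h $ i *\<^sub>R axis i 1)"
      by (simp add: basis_expansion flip: scalar_mult_eq_scaleR)
    also have "\<dots> = (\<Sum>i\<in>UNIV. h $ i * ?D (axis i 1))"
      by (simp add: linear_sum[OF lin] linear_scale[OF lin])
    also have "\<dots> = gradient f x \<bullet> h"
      by (simp add: gradient_def partial_deriv_def inner_vec_def mult.commute)
    finally show ?thesis .
  qed
  then have "?D = (\<lambda>h. gradient f x \<bullet> h)" by auto
  then show ?thesis using D by simp
qed

lemma gradient_eqI: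
  fixes f :: "real^'n::finite \<Rightarrow> real"
  assumes "(f has_derivative (\<lambda>h. g \<bullet> h)) (at x)"
  shows "gradient f x = g" "partial_deriv i f x = g $ i"
proof -
  have "frechet_derivative f (at x) = (\<lambda>h. g \<bullet> h)"
    using frechet_derivative_at[OF assms] by simp
  then show 1: "partial_deriv i f x = g $ i" for i
    by (simp add: partial_deriv_def inner_axis)
  show "gradient f x = g"
    by (simp add: gradient_def vec_eq_iff 1)
qed

text \<open>Uniqueness of the derivative identifies the partial derivatives of \<open>f\<close> with
  the components of a candidate gradient \<open>g\<close>, so a closure property needs only a
  differentiation rule and smoothness of these components.\<close>

lemma k_smooth_SucI:
  fixes f :: "real^'n::finite \<Rightarrow> real"
  assumes "\<And>x. (f has_derivative (\<lambda>h. g x \<bullet> h)) (at x)"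
    and "\<And>i. k_smooth k (\<lambda>x. g x $ i)"
  shows "k_smooth (Suc k) f"
proof -
  have "partial_deriv i f = (\<lambda>x. g x $ i)" for i
    using gradient_eqI(2)[OF assms(1)] by auto
  then show ?thesis
    using assms by (auto simp: differentiable_def)
qed

lemma k_smooth_Suc_deriv:
  fixes f :: "real^'n::finite \<Rightarrow> real"
  assumes "k_smooth (Suc k) f"
  shows "(f has_derivative (\<lambda>h. gradient f x \<bullet> h)) (at x)"
    and "k_smooth k (\<lambda>x. gradient f x $ i)"
proof -
  have "(\<lambda>x. gradient f x $ i) = partial_deriv i f"
    by (auto simp: gradient_def)
  then show "(f has_derivative (\<lambda>h. gradient f x \<bullet> h)) (at x)" "k_smooth k (\<lambda>x. gradient f x $ i)"
    using assms has_derivative_gradient by auto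
qed

lemma k_smooth_SucD:
  fixes f :: "real^'n::finite \<Rightarrow> real"
  shows "k_smooth (Suc k) f \<Longrightarrow> k_smooth k f"
proof (induction k arbitrary: f)
  case 0
  then show ?case
    by (auto intro!: differentiable_imp_continuous_on simp: differentiable_on_def
        intro: differentiable_at_withinI)
next
  case (Suc k)
  then show ?case by simp
qed

lemma k_smooth_continuous:
  fixes f :: "real^'n::finite \<Rightarrow> real"
  shows "k_smooth k f \<Longrightarrow> continuous_on UNIV f"
proof (induction k)
  case (Suc k)
  then show ?case using k_smooth_SucD by blast
qed simp

lemma continuous_on_gradient:
  fixes f :: "real^'n::finite \<Rightarrow> real"
  assumes "k_smooth 1 f"
  shows "continuous_on UNIV (gradient f)"
  using assms unfolding gradient_def
  by (auto intro!: continuous_on_vec_lambda)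

section \<open>Closure properties of \<open>k_smooth\<close>\<close>

lemma k_smooth_const: "k_smooth k (\<lambda>x::real^'n::finite. c)"
proof (induction k arbitrary: c)
  case (Suc k)
  show ?case
    by (rule k_smooth_SucI[where g="\<lambda>_. 0"]) (use Suc in \<open>auto simp del: k_smooth.simps\<close>)
qed simp

lemma k_smooth_add:
  fixes f g :: "real^'n::finite \<Rightarrow> real"
  shows "k_smooth k f \<Longrightarrow> k_smooth k g \<Longrightarrow> k_smooth k (\<lambda>x. f x + g x)"
proof (induction k arbitrary: f g)
  case 0
  then show ?case by (auto intro: continuous_on_add)
next
  case (Suc k)
  note f = k_smooth_Suc_deriv[OF Suc.prems(1)] and g = k_smooth_Suc_deriv[OF Suc.prems(2)]
  show ?case
  proof (rule k_smooth_SucI[where g="\<lambda>x. gradient f x + gradient g x"])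
    show "((\<lambda>x. f x + g x) has_derivative (\<lambda>h. (gradient f x + gradient g x) \<bullet> h)) (at x)" for x
      unfolding inner_add_left by (rule has_derivative_add; rule f g)
    show "k_smooth k (\<lambda>x. (gradient f x + gradient g x) $ i)" for i
      using Suc.IH f g by auto
  qed
qed

lemma k_smooth_mult:
  fixes f g :: "real^'n::finite \<Rightarrow> real"
  shows "k_smooth k f \<Longrightarrow> k_smooth k g \<Longrightarrow> k_smooth k (\<lambda>x. f x * g x)"
proof (induction k arbitrary: f g)
  case 0
  then show ?case by (auto intro: continuous_on_mult)
next
  case (Suc k)
  note f = k_smooth_Suc_deriv[OF Suc.prems(1)] and g = k_smooth_Suc_deriv[OF Suc.prems(2)]
  show ?case
  proof (rule k_smooth_SucI[where g="\<lambda>x. f x *\<^sub>R gradient g x + g x *\<^sub>R gradient f x"])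
    show "((\<lambda>x. f x * g x) has_derivative
        (\<lambda>h. (f x *\<^sub>R gradient g x + g x *\<^sub>R gradient f x) \<bullet> h)) (at x)" for x
      by (rule has_derivative_eq_rhs[OF has_derivative_mult[OF f(1) g(1)]])
        (auto simp: fun_eq_iff inner_add_left)
    show "k_smooth k (\<lambda>x. (f x *\<^sub>R gradient g x + g x *\<^sub>R gradient f x) $ i)" for i
      using k_smooth_add[OF Suc.IH[OF k_smooth_SucD[OF Suc.prems(1)] g(2)[of i]]
          Suc.IH[OF k_smooth_SucD[OF Suc.prems(2)] f(2)[of i]]]
      by simp
  qed
qed

lemma k_smooth_cmult:
  fixes f :: "real^'n::finite \<Rightarrow> real"
  shows "k_smooth k f \<Longrightarrow> k_smooth k (\<lambda>x. c * f x)"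
  by (rule k_smooth_mult) (rule k_smooth_const)

lemma k_smooth_inner: "k_smooth k (\<lambda>x. b \<bullet> (x::real^'n::finite))"
proof (cases k)
  case 0
  then show ?thesis by (simp add: continuous_intros)
next
  case (Suc k)
  have "k_smooth (Suc k) (\<lambda>x. b \<bullet> (x::real^'n::finite))"
    by (rule k_smooth_SucI[where g="\<lambda>_. b"])
      (auto intro!: derivative_eq_intros k_smooth_const simp del: k_smooth.simps)
  then show ?thesis using Suc by simp
qed

lemma k_smooth_inner_self: "k_smooth k (\<lambda>x. x \<bullet> (x::real^'n::finite))"
proof (cases k)
  case 0
  then show ?thesis by (simp add: continuous_intros)
next
  case (Suc k)
  have "k_smooth (Suc k) (\<lambda>x. x \<bullet> (x::real^'n::finite))"
  proof (rule k_smooth_SucI[where g="\<lambda>x. 2 *\<^sub>R x"])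
    show "((\<lambda>x. x \<bullet> x) has_derivative (\<lambda>h. 2 *\<^sub>R x \<bullet> h)) (at x)" for x :: "real^'n"
      by (auto intro!: derivative_eq_intros simp: inner_commute)
    show "k_smooth k (\<lambda>x::real^'n. (2 *\<^sub>R x) $ i)" for i
      using k_smooth_inner[of k "axis i 2 :: real^'n"] by (simp add: inner_axis')
  qed
  then show ?thesis using Suc by simp
qed

lemma k_smooth_affine:
  fixes f :: "real^'n::finite \<Rightarrow> real"
  shows "k_smooth k f \<Longrightarrow> k_smooth k (\<lambda>x. f (c + t *\<^sub>R x))"
proof (induction k arbitrary: f)
  case 0
  then show ?case
    by (auto intro!: continuous_on_compose2[of UNIV f] continuous_intros)
next
  case (Suc k)
  note f = k_smooth_Suc_deriv[OF Suc.prems(1)]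
  show ?case
  proof (rule k_smooth_SucI[where g="\<lambda>x. t *\<^sub>R gradient f (c + t *\<^sub>R x)"])
    have "((\<lambda>x. c + t *\<^sub>R x) has_derivative (\<lambda>h. t *\<^sub>R h)) (at x)" for x :: "real^'n"
      by (auto intro!: derivative_eq_intros)
    then have "((\<lambda>x. f (c + t *\<^sub>R x)) has_derivative (\<lambda>h. gradient f (c + t *\<^sub>R x) \<bullet> (t *\<^sub>R h))) (at x)" for x
      by (rule has_derivative_compose[OF _ f(1)])
    then show "((\<lambda>x. f (c + t *\<^sub>R x)) has_derivative (\<lambda>h. (t *\<^sub>R gradient f (c + t *\<^sub>R x)) \<bullet> h)) (at x)" for x
      by simp
    show "k_smooth k (\<lambda>x. (t *\<^sub>R gradient f (c + t *\<^sub>R x)) $ i)" for i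
      using Suc.IH[OF f(2)] by (simp add: k_smooth_cmult)
  qed
qed

lemma gradient_affine:
  fixes f :: "real^'n::finite \<Rightarrow> real"
  assumes "k_smooth 1 f"
  shows "gradient (\<lambda>x. f (c + t *\<^sub>R x)) x = t *\<^sub>R gradient f (c + t *\<^sub>R x)"
proof (rule gradient_eqI(1))
  have "((\<lambda>x. c + t *\<^sub>R x) has_derivative (\<lambda>h. t *\<^sub>R h)) (at x)"
    by (auto intro!: derivative_eq_intros)
  from has_derivative_compose[OF this has_derivative_gradient[of f]] assms
  show "((\<lambda>x. f (c + t *\<^sub>R x)) has_derivative (\<lambda>h. (t *\<^sub>R gradient f (c + t *\<^sub>R x)) \<bullet> h)) (at x)"
    by simp
qed

text \<open>The gradient of \<open>h s\<close> after \<open>f\<close> is \<open>h' s (f x)\<close>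
  times the gradient of \<open>f\<close>, so the induction closes as soon as \<open>h'\<close> is
  expressible by members of the same family. The index \<open>s\<close> is generalised for this:
  differentiation lowers the exponent of a real power and raises the index of
  \<open>flat\<close>.\<close>

lemma k_smooth_comp:
  fixes f :: "real^'n::finite \<Rightarrow> real" and h :: "'b \<Rightarrow> real \<Rightarrow> real"
  assumes h: "\<And>s x. (h s has_real_derivative h' s (f x)) (at (f x))"
    and step: "\<And>s k. (\<And>s. k_smooth k (\<lambda>x. h s (f x))) \<Longrightarrow>
      k_smooth k (\<lambda>x. h' s (f x))"
  shows "k_smooth k f \<Longrightarrow> k_smooth k (\<lambda>x. h s (f x))"
proof (induction k arbitrary: s)
  case 0
  have "isCont (h s) (f x)" for x using h DERIV_isCont by blast
  moreover have "isCont f x" for x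
    using 0 by (simp add: continuous_on_eq_continuous_at)
  ultimately show ?case
    by (simp add: continuous_on_eq_continuous_at continuous_within_compose3)
next
  case (Suc k)
  note f = k_smooth_Suc_deriv[OF Suc.prems]
  show ?case
  proof (rule k_smooth_SucI[where g="\<lambda>x. h' s (f x) *\<^sub>R gradient f x"])
    show "((\<lambda>x. h s (f x)) has_derivative (\<lambda>v. (h' s (f x) *\<^sub>R gradient f x) \<bullet> v)) (at x)" for x
      using has_derivative_compose[OF f(1) h[unfolded has_field_derivative_def]]
      by (simp add: mult.commute)
    show "k_smooth k (\<lambda>x. (h' s (f x) *\<^sub>R gradient f x) $ i)" for i
      using step[OF Suc.IH] k_smooth_SucD[OF Suc.prems] f(2)
      by (simp add: k_smooth_mult)
  qed
qed

lemma k_smooth_powr: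
  fixes f :: "real^'n::finite \<Rightarrow> real"
  assumes "\<And>x. f x > 0" and "k_smooth k f"
  shows "k_smooth k (\<lambda>x. f x powr s)"
proof (rule k_smooth_comp[where h="\<lambda>s t. t powr s" and h'="\<lambda>s t. s * t powr (s - 1)"])
  show "((\<lambda>t. t powr s) has_real_derivative s * f x powr (s - 1)) (at (f x))" for s x
    using assms(1) by (rule has_real_derivative_powr)
qed (use assms in \<open>auto intro!: k_smooth_cmult\<close>)

text \<open>The powers of \<open>1/t\<close> make the family closed under differentiation.\<close>
definition flat :: "nat \<Rightarrow> real \<Rightarrow> real" where
  "flat m t = (if t > 0 then (1/t) ^ m * exp (- (1/t)) else 0)"

lemma flat_tendsto: "(flat m \<longlongrightarrow> 0) (at 0)"
proof -
  have "((\<lambda>x. x ^ m * exp (- x)) \<longlongrightarrow> (0::real)) at_top"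
    using tendsto_power_div_exp_0[of m] by (simp add: exp_minus divide_inverse)
  then have "((\<lambda>t. (1/t) ^ m * exp (- (1/t))) \<longlongrightarrow> (0::real)) (at_right 0)"
    using filterlim_compose[OF _ filterlim_inverse_at_top_right]
    by (simp add: divide_inverse filterlim_compose)
  then have "(flat m \<longlongrightarrow> 0) (at_right 0)"
    by (rule Lim_transform_eventually) (auto simp: flat_def eventually_at_filter)
  moreover have "(flat m \<longlongrightarrow> 0) (at_left 0)"
    by (rule tendsto_eventually) (auto simp: flat_def eventually_at_filter)
  ultimately show ?thesis
    by (simp add: filterlim_split_at)
qed

lemma flat_has_derivative:
  "(flat m has_real_derivative (- real m * flat (m+1) t + flat (m+2) t)) (at t)"
proof (cases "t = 0")
  case True
  \<comment> \<open>The difference quotient of \<open>flat m\<close> at 0 is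
    \<open>flat (Suc m)\<close> itself, since \<open>flat m 0\<close> is 0.\<close>
  have "(flat (Suc m) \<longlongrightarrow> 0) (at 0)" by (rule flat_tendsto)
  then have "((\<lambda>y. (flat m y - flat m 0) / (y - 0)) \<longlongrightarrow> 0) (at 0)"
    by (rule Lim_transform_eventually)
      (auto simp: flat_def eventually_at_filter power_Suc field_simps)
  then show ?thesis using True
    by (simp add: has_field_derivative_iff) (simp add: flat_def)
next
  case False
  show ?thesis
  proof (cases "t > 0")
    case True
    have 1: "((\<lambda>t. (1/t) ^ m * exp (- (1/t))) has_real_derivative
        (- real m * flat (m+1) t + flat (m+2) t)) (at t)"
    proof -
      have d: "((\<lambda>t. 1/t) has_real_derivative - ((1/t)^2)) (at t)"
        using True by (auto intro!: derivative_eq_intros simp: power2_eq_square)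
      \<comment> \<open>The truncated exponent \<open>m - 1\<close> is harmless at
        \<open>m = 0\<close>, where the factor \<open>real m\<close> vanishes.\<close>
      have "real m * (1/t) ^ (m - 1) * (1/t)^2 = real m * (1/t) ^ (m + 1)"
        by (cases m) (auto simp: power2_eq_square)
      then show ?thesis using True
        by (auto intro!: derivative_eq_intros DERIV_power[OF d] d simp: flat_def algebra_simps power2_eq_square)
    qed
 show ?thesis
      by (rule has_field_derivative_transform_within_open[OF 1, where S="{0<..}"])
        (use True in \<open>auto simp: flat_def\<close>)
  next
    case False
    then have "t < 0" using \<open>t \<noteq> 0\<close> by simp
    have 1: "((\<lambda>t. 0) has_real_derivative (- real m * flat (m+1) t + flat (m+2) t)) (at t)"
      using False by (auto simp: flat_def)
    show ?thesis
      by (rule has_field_derivative_transform_within_open[OF 1, where S="{..<0}"])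
        (use \<open>t < 0\<close> in \<open>auto simp: flat_def\<close>)
  qed
qed

lemma k_smooth_flat:
  fixes f :: "real^'n::finite \<Rightarrow> real"
  assumes "k_smooth k f"
  shows "k_smooth k (\<lambda>x. flat m (f x))"
proof (rule k_smooth_comp[where h=flat])
  show "(flat m has_real_derivative (- real m * flat (m+1) (f x) + flat (m+2) (f x))) (at (f x))" for m x
    by (rule flat_has_derivative)
  show "k_smooth k (\<lambda>x. - real m * flat (m+1) (f x) + flat (m+2) (f x))"
    if "\<And>m. k_smooth k (\<lambda>x. flat m (f x))" for m k
    by (intro k_smooth_add k_smooth_cmult that)
qed (rule assms)

section \<open>A smooth cutoff function and a criterion for test functions\<close>

lemma k_smooth_minus:
  fixes f :: "real^'n::finite \<Rightarrow> real"
  shows "k_smooth k f \<Longrightarrow> k_smooth k (\<lambda>x. - f x)"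
  using k_smooth_cmult[of k f "-1"] by simp

text \<open>\<open>f\<close> vanishes for \<open>norm x \<ge> 2\<close> and \<open>g\<close> for
  \<open>norm x \<le> 1\<close>, never both at one point, so f/(f+g) is smooth and passes from 1 to
  0 on the shell. The arguments use \<open>x \<bullet> x\<close> because the norm is not
  differentiable at 0. Evenness is recorded for the mollifiers built from \<eta>.\<close>

lemma cutoff_exists:
  obtains \<eta> :: "real^'n::finite \<Rightarrow> real" and C
  where "\<And>k. k_smooth k \<eta>" "\<And>x. 0 \<le> \<eta> x" "\<And>x. \<eta> x \<le> 1"
    "\<And>x. norm x \<le> 1 \<Longrightarrow> \<eta> x = 1" "\<And>x. norm x > 2 \<Longrightarrow> \<eta> x = 0"
    "\<And>x. \<eta> (- x) = \<eta> x" "C > 0" "\<And>x. norm (gradient \<eta> x) \<le> C"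
    "\<And>x. norm x < 1 \<or> norm x > 2 \<Longrightarrow> gradient \<eta> x = 0"
proof -
  define f g :: "real^'n \<Rightarrow> real" where "f x = flat 0 (4 - x \<bullet> x)" and "g x = flat 0 (x \<bullet> x - 1)" for x
  \<comment> \<open>Division is written as \<open>powr (-1)\<close> so that
    \<open>k_smooth_powr\<close> covers it.\<close>
  define \<eta> where "\<eta> x = f x * (f x + g x) powr (-1)" for x
  have nn: "f x \<ge> 0" "g x \<ge> 0" for x by (auto simp: f_def g_def flat_def)
  have pos: "f x + g x > 0" for x
    by (auto simp: f_def g_def flat_def intro: add_pos_pos)
  have f: "k_smooth k f" for k
    unfolding f_def diff_conv_add_uminus
    by (intro k_smooth_flat k_smooth_add k_smooth_minus k_smooth_const k_smooth_inner_self)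
  have g: "k_smooth k g" for k
    unfolding g_def diff_conv_add_uminus
    by (intro k_smooth_flat k_smooth_add k_smooth_const k_smooth_inner_self)
  have sm: "k_smooth k \<eta>" for k
    unfolding \<eta>_def by (intro k_smooth_mult k_smooth_powr k_smooth_add f g pos)
  have eq: "\<eta> x = f x / (f x + g x)" for x
    using pos[of x] by (simp add: \<eta>_def powr_minus divide_inverse)
  have 0: "0 \<le> \<eta> x" "\<eta> x \<le> 1" for x
    using nn[of x] pos[of x] by (auto simp: eq)
  have sq: "norm x \<le> 1 \<longleftrightarrow> x \<bullet> x \<le> 1" "norm x > 2 \<longleftrightarrow> x \<bullet> x > 4" for x :: "real^'n"
    using norm_le_square[of x 1] norm_gt_square[of 2 x] by (auto simp: power2_eq_square)
  have 1: "\<eta> x = 1" if "norm x \<le> 1" for x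
    using that nn[of x] pos[of x] by (simp add: eq sq) (simp add: g_def flat_def)
  have 2: "\<eta> x = 0" if "norm x > 2" for x
    using that by (simp add: eq sq) (simp add: f_def flat_def)
  have der: "(\<eta> has_derivative (\<lambda>h. gradient \<eta> x \<bullet> h)) (at x)" for x
    using k_smooth_Suc_deriv[OF sm[of "Suc 0"]] by blast
  have 3: "gradient \<eta> x = 0" if x: "norm x < 1 \<or> norm x > 2" for x
  proof (rule gradient_eqI)
    have "open {x::real^'n. norm x < 1}" "open {x::real^'n. norm x > 2}"
      by (auto intro!: open_Collect_less continuous_intros)
    \<comment> \<open>\<open>T\<close> is one of the two open regions, on which \<eta> has the
      constant value \<open>c\<close>, either 1 or 0.\<close>
    then obtain T c where T: "open T" "x \<in> T" "\<And>y. y \<in> T \<Longrightarrow> \<eta> y = c"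
      using x 1 2 by (metis (no_types, lifting) less_imp_le mem_Collect_eq)
    have "((\<lambda>y. c) has_derivative (\<lambda>h. 0 \<bullet> h)) (at x)" by simp
    then show "(\<eta> has_derivative (\<lambda>h. 0 \<bullet> h)) (at x)"
      by (rule has_derivative_transform_within_open[OF _ T(1,2)]) (use T(3) in auto)
  qed
  have "compact (gradient \<eta> ` cball 0 2)"
    using continuous_on_gradient[OF sm] by (intro compact_continuous_image) (auto intro: continuous_on_subset)
  then obtain C where C: "C > 0" "\<And>x. norm x \<le> 2 \<Longrightarrow> norm (gradient \<eta> x) \<le> C"
    using compact_imp_bounded bounded_pos by (metis (no_types, opaque_lifting) imageI mem_cball_0)
  have "norm (gradient \<eta> x) \<le> C" for x
    using C 3[of x] by (cases "norm x \<le> 2") auto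
  moreover have "\<eta> (- x) = \<eta> x" for x by (simp add: \<eta>_def f_def g_def)
  ultimately show ?thesis using that[of \<eta> C] sm 0 1 2 3 C by blast
qed

lemma test_functionsI:
  fixes f :: "real^'n::finite \<Rightarrow> real"
  assumes "\<And>k. k_smooth k f" "\<And>x. norm (x - c) > r \<Longrightarrow> f x = 0"
  shows "f \<in> test_functions"
proof -
  have "{x. f x \<noteq> 0} \<subseteq> cball c r"
    using assms(2) by (force simp: dist_norm norm_minus_commute)
  then have "bounded {x. f x \<noteq> 0}" using bounded_subset bounded_cball by blast
  then show ?thesis using assms(1) by (simp add: test_functions_def)
qed

section \<open>Mollification\<close>

text \<open>Borel rather than Lebesgue measurability, so that the kernel integrands are jointly
  measurable and Tonelli's theorem for \<open>lborel\<close> applies. Balls about 0 exhaust the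
  space.\<close>

definition loc_integrable :: "('a::euclidean_space \<Rightarrow> 'b::euclidean_space) \<Rightarrow> bool" where
  "loc_integrable f \<longleftrightarrow> f \<in> borel_measurable borel \<and> (\<forall>R. set_integrable lborel (cball 0 R) f)"

definition mollify :: "('a::euclidean_space \<Rightarrow> real) \<Rightarrow> ('a \<Rightarrow> 'b::euclidean_space) \<Rightarrow> 'a \<Rightarrow> 'b" where
  "mollify \<rho> f x = (\<integral>y. \<rho> (x - y) *\<^sub>R f y \<partial>lborel)"

text \<open>An explicit radius instead of a rescaled family lets \<open>r\<close> be chosen under
  several constraints at once. Evenness makes \<open>\<rho> (x - y)\<close> and
  \<open>\<rho> (y - x)\<close> equal, hence of mass 1 in either variable. Smoothness is a separate
  hypothesis wherever derivatives occur.\<close>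

definition mollifier :: "real \<Rightarrow> ('a::euclidean_space \<Rightarrow> real) \<Rightarrow> bool" where
  "mollifier r \<rho> \<longleftrightarrow> continuous_on UNIV \<rho> \<and> (\<forall>x. 0 \<le> \<rho> x) \<and> (\<forall>x. \<rho> (- x) = \<rho> x) \<and>
     (\<forall>x. norm x > r \<longrightarrow> \<rho> x = 0) \<and> integral\<^sup>L lborel \<rho> = 1"

lemma continuous_loc_integrable:
  fixes f :: "'a::euclidean_space \<Rightarrow> 'b::euclidean_space"
  assumes "continuous_on UNIV f"
  shows "loc_integrable f"
  unfolding loc_integrable_def set_integrable_def
  using assms by (auto intro!: borel_measurable_continuous_onI borel_integrable_compact
      intro: continuous_on_subset)

text \<open>For fixed \<open>x\<close> the kernel is bounded and lives on the ball of radius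
  \<open>r\<close> about \<open>x\<close>, hence inside \<open>cball 0 (norm x + r)\<close>, where
  \<open>f\<close> is integrable.\<close>

lemma integrable_kernel:
  fixes f :: "'a::euclidean_space \<Rightarrow> 'b::euclidean_space"
  assumes f: "loc_integrable f" and c: "continuous_on UNIV \<rho>"
    and r: "\<And>x. norm x > r \<Longrightarrow> \<rho> x = 0"
  shows "integrable lborel (\<lambda>y. \<rho> (x - y) *\<^sub>R f y)"
proof -
  have "bounded (\<rho> ` cball 0 r)"
    by (intro compact_imp_bounded compact_continuous_image continuous_on_subset[OF c]) auto
  then obtain B where B: "B > 0" "\<And>x. norm x \<le> r \<Longrightarrow> \<bar>\<rho> x\<bar> \<le> B"
    unfolding bounded_pos by auto
  have [measurable]: "f \<in> borel_measurable borel" "\<rho> \<in> borel_measurable borel"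
    using f c by (auto simp: loc_integrable_def borel_measurable_continuous_onI)
  have "integrable lborel (\<lambda>y. B *\<^sub>R (indicator (cball 0 (norm x + r)) y *\<^sub>R f y))"
    using f by (intro integrable_scaleR_right) (simp add: loc_integrable_def set_integrable_def)
  then show ?thesis
  proof (rule Bochner_Integration.integrable_bound)
    show "AE y in lborel. norm (\<rho> (x - y) *\<^sub>R f y) \<le> norm (B *\<^sub>R (indicator (cball 0 (norm x + r)) y *\<^sub>R f y))"
    proof (intro AE_I2)
      fix y
      show "norm (\<rho> (x - y) *\<^sub>R f y) \<le> norm (B *\<^sub>R (indicator (cball 0 (norm x + r)) y *\<^sub>R f y))"
      proof (cases "norm (x - y) \<le> r")
        case True
        moreover have "norm y \<le> norm x + norm (x - y)"
          by (metis norm_minus_commute norm_triangle_sub)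
        ultimately show ?thesis using B by (auto simp: indicator_def intro!: mult_right_mono)
      next
        case False
        then show ?thesis using r[of "x - y"] by simp
      qed
    qed
  qed simp
qed

lemma mollifierD:
  fixes \<rho> :: "'a::euclidean_space \<Rightarrow> real"
  assumes "mollifier r \<rho>"
  shows "continuous_on UNIV \<rho>" "\<rho> \<in> borel_measurable borel" "0 \<le> \<rho> x" "\<rho> (- x) = \<rho> x"
    "norm x > r \<Longrightarrow> \<rho> x = 0" "integrable lborel \<rho>"
    "integrable lborel (\<lambda>y. \<rho> (y - x))" "(\<integral>y. \<rho> (y - x) \<partial>lborel) = 1"
    "integrable lborel (\<lambda>y. \<rho> (x - y))" "(\<integral>y. \<rho> (x - y) \<partial>lborel) = 1"
proof -
  show c: "continuous_on UNIV \<rho>" and "0 \<le> \<rho> x" "\<rho> (- x) = \<rho> x" "norm x > r \<Longrightarrow> \<rho> x = 0"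
    using assms by (auto simp: mollifier_def)
  show m[measurable]: "\<rho> \<in> borel_measurable borel" using c by (rule borel_measurable_continuous_onI)
  have 1: "integral\<^sup>L lborel \<rho> = 1" using assms by (simp add: mollifier_def)
  then show i: "integrable lborel \<rho>" using not_integrable_integral_eq by fastforce
  have d: "distr lborel borel ((+) (- x)) = lborel" by (rule lborel_distr_plus)
  have "integrable (distr lborel borel ((+) (- x))) \<rho>" "integral\<^sup>L (distr lborel borel ((+) (- x))) \<rho> = 1"
    using i 1 by (simp_all only: d)
  then show 2: "integrable lborel (\<lambda>y. \<rho> (y - x))" "(\<integral>y. \<rho> (y - x) \<partial>lborel) = 1"
    by (simp_all add: integrable_distr_eq integral_distr)
  have "\<rho> (x - y) = \<rho> (y - x)" for y using assms unfolding mollifier_def by (metis minus_diff_eq)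
  then show "integrable lborel (\<lambda>y. \<rho> (x - y))" "(\<integral>y. \<rho> (x - y) \<partial>lborel) = 1"
    using 2 by simp_all
qed

section \<open>Mollification in L^1 on balls\<close>

lemma measurable_mollify:
  fixes f :: "'a::euclidean_space \<Rightarrow> 'b::euclidean_space"
  assumes [measurable]: "f \<in> borel_measurable borel" and "continuous_on UNIV \<rho>"
  shows "mollify \<rho> f \<in> borel_measurable borel"
proof -
  have [measurable]: "\<rho> \<in> borel_measurable borel" using assms(2) by (rule borel_measurable_continuous_onI)
  show ?thesis unfolding mollify_def by measurable
qed

text \<open>Tonelli's theorem moves the integral in \<open>x\<close> onto the kernel, where it
  contributes mass at most 1. A point \<open>y\<close> influences \<open>cball 0 R\<close> only if
  \<open>norm y \<le> R + r\<close>, hence the larger ball on the right.\<close>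

lemma mollify_ball_bound:
  fixes f :: "'a::euclidean_space \<Rightarrow> 'b::euclidean_space"
  assumes f: "loc_integrable f" and \<rho>: "mollifier r \<rho>"
  shows "(\<integral>\<^sup>+x\<in>cball 0 R. norm (mollify \<rho> f x) \<partial>lborel) \<le> (\<integral>\<^sup>+x\<in>cball 0 (R + r). norm (f x) \<partial>lborel)"
proof -
  note \<rho>D = mollifierD[OF \<rho>]
  note [measurable] = \<rho>D(2)
  have [measurable]: "f \<in> borel_measurable borel" using f by (simp add: loc_integrable_def)
  have [measurable]: "cball (0::'a) R \<in> sets lborel" by simp
  have "(\<integral>\<^sup>+x\<in>cball 0 R. norm (mollify \<rho> f x) \<partial>lborel)
      \<le> (\<integral>\<^sup>+x. (\<integral>\<^sup>+y. ennreal (\<rho> (x - y) * norm (f y)) * indicator (cball 0 R) x \<partial>lborel) \<partial>lborel)"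
  proof (rule nn_integral_mono)
    fix x :: 'a
    have "ennreal (norm (mollify \<rho> f x)) \<le> (\<integral>\<^sup>+y. norm (\<rho> (x - y) *\<^sub>R f y) \<partial>lborel)"
      unfolding mollify_def
      by (intro integral_norm_bound_ennreal integrable_kernel[OF f \<rho>D(1,5)])
    then show "ennreal (norm (mollify \<rho> f x)) * indicator (cball 0 R) x
      \<le> (\<integral>\<^sup>+y. ennreal (\<rho> (x - y) * norm (f y)) * indicator (cball 0 R) x \<partial>lborel)"
      using \<rho>D(3) by (auto simp: indicator_def)
  qed
  also have "\<dots> = (\<integral>\<^sup>+y. (\<integral>\<^sup>+x. ennreal (\<rho> (x - y) * norm (f y)) * indicator (cball 0 R) x \<partial>lborel) \<partial>lborel)"
    by (rule lborel_pair.Fubini') (simp add: split_beta')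
  also have "\<dots> \<le> (\<integral>\<^sup>+x\<in>cball 0 (R + r). norm (f x) \<partial>lborel)"
  proof (rule nn_integral_mono)
    fix y :: 'a
    have "(\<integral>\<^sup>+x. ennreal (\<rho> (x - y) * norm (f y)) * indicator (cball 0 R) x \<partial>lborel)
        \<le> (\<integral>\<^sup>+x. ennreal (\<rho> (x - y)) * (ennreal (norm (f y)) * indicator (cball 0 (R + r)) y) \<partial>lborel)"
    proof (rule nn_integral_mono)
      fix x :: 'a
      show "ennreal (\<rho> (x - y) * norm (f y)) * indicator (cball 0 R) x
          \<le> ennreal (\<rho> (x - y)) * (ennreal (norm (f y)) * indicator (cball 0 (R + r)) y)"
      proof (cases "norm (x - y) > r")
        case True
        then show ?thesis using \<rho>D(5) by simp
      next
        case False
        moreover have "norm y \<le> norm x + norm (x - y)"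
          by (metis norm_minus_commute norm_triangle_sub)
        ultimately show ?thesis using \<rho>D(3) by (auto simp: indicator_def ennreal_mult)
      qed
    qed
    also have "\<dots> = (\<integral>\<^sup>+x. ennreal (\<rho> (x - y)) \<partial>lborel) * (ennreal (norm (f y)) * indicator (cball 0 (R + r)) y)"
      by (rule nn_integral_multc) measurable
    also have "(\<integral>\<^sup>+x. ennreal (\<rho> (x - y)) \<partial>lborel) = 1"
      using nn_integral_eq_integral[OF \<rho>D(7)[of y]] \<rho>D(3,8) by simp
    finally show "(\<integral>\<^sup>+x. ennreal (\<rho> (x - y) * norm (f y)) * indicator (cball 0 R) x \<partial>lborel)
        \<le> ennreal (norm (f y)) * indicator (cball 0 (R + r)) y" by simp
  qed
  finally show ?thesis .
qed

lemma mollify_diff: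
  fixes f g :: "'a::euclidean_space \<Rightarrow> 'b::euclidean_space"
  assumes "loc_integrable f" "loc_integrable g" "mollifier r \<rho>"
  shows "mollify \<rho> (\<lambda>x. f x - g x) x = mollify \<rho> f x - mollify \<rho> g x"
  unfolding mollify_def scaleR_diff_right
  by (intro Bochner_Integration.integral_diff integrable_kernel assms mollifierD(1,5)[OF assms(3)])

text \<open>Because \<rho> has mass 1, the difference is the average of \<open>g y - c\<close> over
  the ball of radius \<open>r\<close> with weight \<rho>. The value \<open>c\<close> is free: it is
  \<open>g x\<close> for convergence and the midpoint of an interval for lower bounds.\<close>

lemma mollify_near:
  fixes g :: "'a::euclidean_space \<Rightarrow> 'b::euclidean_space"
  assumes g: "loc_integrable g" and \<rho>: "mollifier r \<rho>"
    and e: "\<And>y. norm (y - x) \<le> r \<Longrightarrow> norm (g y - c) \<le> e"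
  shows "norm (mollify \<rho> g x - c) \<le> e"
proof -
  note \<rho>D = mollifierD[OF \<rho>]
  have *: "integrable lborel (\<lambda>y. \<rho> (x - y) *\<^sub>R (g y - c))"
    unfolding scaleR_diff_right
    by (intro Bochner_Integration.integrable_diff integrable_kernel[OF g \<rho>D(1,5)] integrable_scaleR_left \<rho>D)
  have "mollify \<rho> g x - c = (\<integral>y. \<rho> (x - y) *\<^sub>R (g y - c) \<partial>lborel)"
    unfolding mollify_def scaleR_diff_right
    using \<rho>D(9,10) by (subst Bochner_Integration.integral_diff) (auto intro!: integrable_kernel[OF g \<rho>D(1,5)])
  also have "norm \<dots> \<le> (\<integral>y. norm (\<rho> (x - y) *\<^sub>R (g y - c)) \<partial>lborel)"
    by (rule integral_norm_bound)
  also have "\<dots> \<le> (\<integral>y. \<rho> (x - y) * e \<partial>lborel)"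
  proof (rule integral_mono)
    show "norm (\<rho> (x - y) *\<^sub>R (g y - c)) \<le> \<rho> (x - y) * e" for y
      using e[of y] \<rho>D(3)[of "x - y"] \<rho>D(5)[of "x - y"]
      by (cases "norm (x - y) > r") (auto intro: mult_left_mono simp: norm_minus_commute)
  qed (use integrable_norm[OF *] \<rho>D(9) in auto)
  also have "\<dots> = e" using \<rho>D(10) by simp
  finally show ?thesis .
qed

text \<open>Measurability supplies continuous \<open>h n\<close> converging to \<open>F\<close>
  almost everywhere, but without a common bound. Composing with the continuous truncation
  \<open>T M\<close> bounds them by \<open>M + 1\<close>, so dominated convergence applies on the
  ball; and \<open>T M\<close> changes \<open>F\<close> little in L^1 for large
  \<open>M\<close>.\<close>

lemma L1_approx_continuous:
  fixes f :: "'a::euclidean_space \<Rightarrow> 'b::euclidean_space"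
  assumes f: "loc_integrable f" and "e > 0"
  obtains g where "continuous_on UNIV g" "(\<integral>\<^sup>+x\<in>cball 0 R. norm (f x - g x) \<partial>lborel) < ennreal e"
proof -
  let ?K = "cball (0::'a) R"
  have [measurable]: "?K \<in> sets lborel" by simp
  define F where "F x = indicator ?K x *\<^sub>R f x" for x
  have F: "integrable lborel F" and [measurable]: "f \<in> borel_measurable borel"
    using f by (auto simp: F_def[abs_def] loc_integrable_def set_integrable_def)
  have [measurable]: "F \<in> borel_measurable borel" using borel_measurable_integrable[OF F] by simp
  \<comment> \<open>Radial projection onto the ball of radius \<open>M + 1\<close>;
    \<open>Suc\<close> keeps the denominator positive even for \<open>M = 0\<close> and
    \<open>v = 0\<close>.\<close>
  define T :: "nat \<Rightarrow> 'b \<Rightarrow> 'b" where "T M v = (real (Suc M) / max (real (Suc M)) (norm v)) *\<^sub>R v" for M v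
  have T1: "norm (T M v) \<le> norm v" for M v
    by (auto simp: T_def divide_simps mult_left_mono max_def intro: mult_right_mono)
  have T2: "norm (T M v) \<le> real (Suc M)" for M v
    by (auto simp: T_def divide_simps max_def)
  have T3: "T M v = v" if "norm v \<le> real M" for M v
    using that by (auto simp: T_def max_def)
  have T4: "continuous_on UNIV (T M)" for M
    unfolding T_def by (intro continuous_intros) (auto simp: max_def)
  have [measurable]: "T M \<in> borel_measurable borel" for M
    using T4 by (rule borel_measurable_continuous_onI)
  have "(\<lambda>M. \<integral>\<^sup>+x. norm (F x - T M (F x)) \<partial>lborel) \<longlonglongrightarrow> 0"
  proof (rule nn_integral_dominated_convergence_norm[where w="\<lambda>x. norm (F x)"])
    show "AE x in lborel. (\<lambda>i. T i (F x)) \<longlonglongrightarrow> F x"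
    proof (intro AE_I2 tendsto_eventually)
      fix x
      obtain N where N: "norm (F x) \<le> real N" using real_arch_simple by blast
      show "\<forall>\<^sub>F i in sequentially. T i (F x) = F x"
        using eventually_ge_at_top[of N]
      proof eventually_elim
        case (elim i)
        then show ?case using N T3[of "F x" i] by simp
      qed
    qed
  qed (use F T1 in \<open>auto simp: integrable_iff_bounded\<close>)
  then have "\<forall>\<^sub>F M in sequentially. (\<integral>\<^sup>+x. norm (F x - T M (F x)) \<partial>lborel) < ennreal (e/2)"
    using \<open>e > 0\<close> by (intro order_tendstoD(2)) auto
  then obtain M where M: "(\<integral>\<^sup>+x. norm (F x - T M (F x)) \<partial>lborel) < ennreal (e/2)"
    using eventually_sequentially by (meson order_refl)
  have "F measurable_on UNIV"
    by (intro lebesgue_measurable_imp_measurable_on) (auto intro: measurable_completion)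
  then obtain N h where N: "negligible N" and h: "\<And>n. continuous_on UNIV (h n)"
      "\<And>x. x \<notin> N \<Longrightarrow> (\<lambda>n. h n x) \<longlonglongrightarrow> F x"
    unfolding measurable_on_def by auto
  have [measurable]: "h n \<in> borel_measurable borel" for n
    using h(1) by (rule borel_measurable_continuous_onI)
  have "AE x in lebesgue. x \<notin> N"
    using N by (simp add: negligible_iff_null_sets AE_not_in)
  then have AEN: "AE x in lborel. x \<notin> N" by (simp add: AE_completion_iff)
  have "(\<lambda>n. \<integral>\<^sup>+x. norm (T M (F x) - indicator ?K x *\<^sub>R T M (h n x)) \<partial>lborel) \<longlonglongrightarrow> 0"
  proof (rule nn_integral_dominated_convergence_norm[where w="\<lambda>x. real (Suc M) * indicator ?K x"])
    show "(\<integral>\<^sup>+x. ennreal (real (Suc M) * indicator ?K x) \<partial>lborel) < \<infinity>"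
      unfolding ennreal_mult'[OF of_nat_0_le_iff]
      by (subst ennreal_indicator, subst nn_integral_cmult_indicator)
        (use emeasure_lborel_cball_finite[of 0 R] in \<open>auto simp: ennreal_mult_less_top\<close>)
    show "AE x in lborel. norm (indicator ?K x *\<^sub>R T M (h j x)) \<le> real (Suc M) * indicator ?K x" for j
      using T2 by (auto simp: indicator_def)
    show "AE x in lborel. (\<lambda>i. indicator ?K x *\<^sub>R T M (h i x)) \<longlonglongrightarrow> T M (F x)"
      using AEN
    proof eventually_elim
      case (elim x)
      have "isCont (T M) (F x)" using T4 by (simp add: continuous_on_eq_continuous_at)
      then have "(\<lambda>i. T M (h i x)) \<longlonglongrightarrow> T M (F x)"
        by (rule isCont_tendsto_compose) (rule h(2)[OF elim])
      then show ?case by (cases "x \<in> ?K") (auto simp: F_def T_def)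
    qed
  qed measurable
  then have "\<forall>\<^sub>F n in sequentially. (\<integral>\<^sup>+x. norm (T M (F x) - indicator ?K x *\<^sub>R T M (h n x)) \<partial>lborel) < ennreal (e/2)"
    using \<open>e > 0\<close> by (intro order_tendstoD(2)) auto
  then obtain n where n: "(\<integral>\<^sup>+x. norm (T M (F x) - indicator ?K x *\<^sub>R T M (h n x)) \<partial>lborel) < ennreal (e/2)"
    using eventually_sequentially by (meson order_refl)
  show thesis
  proof (rule that)
    \<comment> \<open>The indicator is dropped to keep continuity; outside the ball the error is not
      measured.\<close>
    show "continuous_on UNIV (\<lambda>x. T M (h n x))"
      by (rule continuous_on_compose2[OF T4 h(1)]) auto
    have "(\<integral>\<^sup>+x\<in>?K. norm (f x - T M (h n x)) \<partial>lborel) \<le>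
      (\<integral>\<^sup>+x. ennreal (norm (F x - T M (F x))) + ennreal (norm (T M (F x) - indicator ?K x *\<^sub>R T M (h n x))) \<partial>lborel)"
    proof (intro nn_integral_mono)
      fix x
      show "ennreal (norm (f x - T M (h n x))) * indicator ?K x \<le> ennreal (norm (F x - T M (F x)))
        + ennreal (norm (T M (F x) - indicator ?K x *\<^sub>R T M (h n x)))"
        using norm_triangle_ineq[of "f x - T M (f x)" "T M (f x) - T M (h n x)"]
        by (auto simp: F_def indicator_def ennreal_leI simp flip: ennreal_plus)
    qed
    also have "\<dots> = (\<integral>\<^sup>+x. norm (F x - T M (F x)) \<partial>lborel)
       + (\<integral>\<^sup>+x. norm (T M (F x) - indicator ?K x *\<^sub>R T M (h n x)) \<partial>lborel)"
      by (rule nn_integral_add) measurable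
    also have "\<dots> < ennreal (e/2) + ennreal (e/2)" using M n by (rule add_strict_mono)
    also have "\<dots> = ennreal e" using \<open>e > 0\<close> by (simp flip: ennreal_plus)
    finally show "(\<integral>\<^sup>+x\<in>?K. norm (f x - T M (h n x)) \<partial>lborel) < ennreal e" .
  qed
qed

text \<open>Three errors of size \<open>e/3\<close>: the mollification of \<open>f - g\<close>,
  controlled by \<open>mollify_ball_bound\<close>; the change of \<open>g\<close> under
  mollification, controlled by uniform continuity; and \<open>f - g\<close> itself. The bound
  depends on the mollifier only through its radius, so \<open>d\<close> can be combined with other
  constraints.\<close>

lemma mollify_L1:
  fixes f :: "'a::euclidean_space \<Rightarrow> 'b::euclidean_space"
  assumes f: "loc_integrable f" and "e > 0"
  obtains d where "d > 0"
    "\<And>r \<rho>. mollifier r \<rho> \<Longrightarrow> r \<le> d \<Longrightarrow>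
      (\<integral>\<^sup>+x\<in>cball 0 R. norm (mollify \<rho> f x - f x) \<partial>lborel) \<le> ennreal e"
proof -
  have fm[measurable]: "f \<in> borel_measurable borel" using f by (simp add: loc_integrable_def)
  obtain g where g: "continuous_on UNIV g" 
    and fg: "(\<integral>\<^sup>+x\<in>cball 0 (R + 1). norm (f x - g x) \<partial>lborel) < ennreal (e/3)"
    using L1_approx_continuous[OF f, of "e/3" "R + 1"] \<open>e > 0\<close> by auto
  have gl: "loc_integrable g" using g by (rule continuous_loc_integrable)
  have gm[measurable]: "g \<in> borel_measurable borel" using g by (rule borel_measurable_continuous_onI)
  define V where "V = measure lborel (cball (0::'a) R)"
  \<comment> \<open>\<open>V + 1\<close> rather than \<open>V\<close>, because the ball may be
    null.\<close>
  define \<delta> where "\<delta> = e / 3 / (V + 1)"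
  have V: "V \<ge> 0" by (simp add: V_def)
  have \<delta>: "\<delta> > 0" "\<delta> * V \<le> e / 3"
    using V \<open>e > 0\<close> by (auto simp: \<delta>_def divide_simps mult_left_mono)
  have "uniformly_continuous_on (cball 0 (R + 1)) g"
    by (intro compact_uniformly_continuous continuous_on_subset[OF g]) auto
  then obtain d0 where d0: "d0 > 0"
    "\<And>x y. x \<in> cball 0 (R+1) \<Longrightarrow> y \<in> cball 0 (R+1) \<Longrightarrow> dist y x < d0 \<Longrightarrow> dist (g y) (g x) < \<delta>"
    unfolding uniformly_continuous_on_def using \<delta>(1) by meson
  \<comment> \<open>At most 1, so that points within \<open>r\<close> of \<open>cball 0 R\<close>
    remain in \<open>cball 0 (R + 1)\<close>, where \<open>g\<close> is uniformly continuous and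
    close to \<open>f\<close> in L^1.\<close>
  define d where "d = min 1 (d0 / 2)"
  have d: "d > 0" "d \<le> 1" "d < d0" using d0(1) by (auto simp: d_def)
  show thesis
  proof (rule that[OF d(1)])
    fix r and \<rho> :: "'a \<Rightarrow> real"
    assume \<rho>: "mollifier r \<rho>" and r: "r \<le> d"
    note [measurable] = measurable_mollify[OF fm mollifierD(1)[OF \<rho>]] measurable_mollify[OF gm mollifierD(1)[OF \<rho>]]
    have fgl: "loc_integrable (\<lambda>x. f x - g x)"
      using f gl by (auto simp: loc_integrable_def intro: set_integral_diff)
    have "(\<integral>\<^sup>+x\<in>cball 0 R. norm (mollify \<rho> f x - f x) \<partial>lborel)
      \<le> (\<integral>\<^sup>+x. ennreal (norm (mollify \<rho> (\<lambda>x. f x - g x) x)) * indicator (cball 0 R) x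
            + (ennreal \<delta> * indicator (cball 0 R) x + ennreal (norm (f x - g x)) * indicator (cball 0 R) x) \<partial>lborel)"
    proof (rule nn_integral_mono)
      fix x :: 'a
      have "norm (mollify \<rho> f x - f x) \<le> norm (mollify \<rho> (\<lambda>x. f x - g x) x) + (\<delta> + norm (f x - g x))"
        if x: "x \<in> cball 0 R"
      proof -
        have "norm (mollify \<rho> g x - g x) \<le> \<delta>"
        proof (rule mollify_near[OF gl \<rho>])
          fix y assume y: "norm (y - x) \<le> r"
          then have "norm y \<le> R + 1"
            using x r d norm_triangle_sub[of y x] by auto
          then show "norm (g y - g x) \<le> \<delta>"
            using d0(2)[of x y] x y r d by (auto simp: dist_norm)
        qed
        moreover have "mollify \<rho> f x - f x = mollify \<rho> (\<lambda>x. f x - g x) x + ((mollify \<rho> g x - g x) - (f x - g x))"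
          using mollify_diff[OF f gl \<rho>] by simp
        ultimately show ?thesis
          by (smt (verit) norm_triangle_ineq norm_triangle_ineq4)
      qed
      then show "ennreal (norm (mollify \<rho> f x - f x)) * indicator (cball 0 R) x
        \<le> ennreal (norm (mollify \<rho> (\<lambda>x. f x - g x) x)) * indicator (cball 0 R) x
            + (ennreal \<delta> * indicator (cball 0 R) x + ennreal (norm (f x - g x)) * indicator (cball 0 R) x)"
        using \<delta>(1) by (auto simp: indicator_def ennreal_leI simp flip: ennreal_plus)
    qed
    also have "\<dots> = (\<integral>\<^sup>+x\<in>cball 0 R. norm (mollify \<rho> (\<lambda>x. f x - g x) x) \<partial>lborel)
       + ((\<integral>\<^sup>+x\<in>cball (0::'a) R. ennreal \<delta> \<partial>lborel) + (\<integral>\<^sup>+x\<in>cball 0 R. norm (f x - g x) \<partial>lborel))"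
    proof -
      have [measurable]: "cball (0::'a) R \<in> sets lborel" by simp
      have [measurable]: "mollify \<rho> (\<lambda>x. f x - g x) \<in> borel_measurable borel"
        by (rule measurable_mollify[OF _ mollifierD(1)[OF \<rho>]]) measurable
      show ?thesis by (simp add: nn_integral_add)
    qed
    also have "\<dots> \<le> ennreal (e/3) + (ennreal (e/3) + ennreal (e/3))"
    proof (intro add_mono)
      have "(\<integral>\<^sup>+x\<in>cball 0 R. norm (mollify \<rho> (\<lambda>x. f x - g x) x) \<partial>lborel)
        \<le> (\<integral>\<^sup>+x\<in>cball 0 (R + r). norm (f x - g x) \<partial>lborel)"
        by (rule mollify_ball_bound[OF fgl \<rho>])
      also have "\<dots> \<le> (\<integral>\<^sup>+x\<in>cball 0 (R + 1). norm (f x - g x) \<partial>lborel)"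
        using r d by (intro nn_integral_mono) (auto simp: indicator_def)
      finally show "(\<integral>\<^sup>+x\<in>cball 0 R. norm (mollify \<rho> (\<lambda>x. f x - g x) x) \<partial>lborel) \<le> ennreal (e/3)"
        using fg by simp
      have "(\<integral>\<^sup>+x\<in>cball 0 R. norm (f x - g x) \<partial>lborel) \<le> (\<integral>\<^sup>+x\<in>cball 0 (R + 1). norm (f x - g x) \<partial>lborel)"
        by (intro nn_integral_mono) (auto simp: indicator_def)
      then show "(\<integral>\<^sup>+x\<in>cball 0 R. norm (f x - g x) \<partial>lborel) \<le> ennreal (e/3)"
        using fg by simp
      have "(\<integral>\<^sup>+x\<in>cball (0::'a) R. ennreal \<delta> \<partial>lborel) = ennreal \<delta> * ennreal V"
        using emeasure_lborel_cball_finite[of "0::'a" R]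
        by (simp add: nn_integral_cmult_indicator V_def emeasure_eq_ennreal_measure)
      then show "(\<integral>\<^sup>+x\<in>cball (0::'a) R. ennreal \<delta> \<partial>lborel) \<le> ennreal (e/3)"
        using \<delta> V by (simp add: ennreal_leI flip: ennreal_mult)
    qed
    also have "\<dots> = ennreal e" using \<open>e > 0\<close> by (simp flip: ennreal_plus)
    finally show "(\<integral>\<^sup>+x\<in>cball 0 R. norm (mollify \<rho> f x - f x) \<partial>lborel) \<le> ennreal e" .
  qed
qed

section \<open>Smoothness of mollifications, with derivatives falling on the kernel\<close>

lemma mollify_eq_integral:
  fixes u :: "'a::euclidean_space \<Rightarrow> real"
  assumes \<rho>: "continuous_on UNIV \<rho>" "\<And>x. norm x > r \<Longrightarrow> \<rho> x = 0" and u: "continuous_on UNIV u"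
    and sub: "cball x r \<subseteq> cbox a b"
  shows "(\<lambda>y. \<rho> (x - y) * u y) integrable_on cbox a b"
    and "mollify \<rho> u x = integral (cbox a b) (\<lambda>y. \<rho> (x - y) * u y)"
proof -
  have "set_integrable lborel (cbox a b) (\<lambda>y. \<rho> (x - y) * u y)"
    unfolding set_integrable_def
    by (intro borel_integrable_compact continuous_intros continuous_on_compose2[OF \<rho>(1)]
        continuous_on_subset[OF u]) auto
  note S = set_borel_integral_eq_integral[OF this]
  show "(\<lambda>y. \<rho> (x - y) * u y) integrable_on cbox a b" by (rule S(1))
  have "\<rho> (x - y) *\<^sub>R u y = indicator (cbox a b) y *\<^sub>R (\<rho> (x - y) * u y)" for y
  proof (cases "y \<in> cbox a b")
    case False
    then have "y \<notin> cball x r" using sub by blast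
    then have "norm (x - y) > r" by (simp add: dist_norm)
    then show ?thesis using \<rho>(2) by simp
  qed simp
  then have "mollify \<rho> u x = (LINT y : cbox a b | lborel. \<rho> (x - y) * u y)"
    unfolding mollify_def set_lebesgue_integral_def by (intro Bochner_Integration.integral_cong refl)
  then show "mollify \<rho> u x = integral (cbox a b) (\<lambda>y. \<rho> (x - y) * u y)"
    using S(2) by simp
qed

lemma partial_deriv_vanishes:
  fixes f :: "real^'n::finite \<Rightarrow> real"
  assumes "\<And>x. norm x > r \<Longrightarrow> f x = 0" "norm x > r"
  shows "partial_deriv i f x = 0"
proof -
  have "open {x::real^'n. norm x > r}" by (auto intro!: open_Collect_less continuous_intros)
  moreover have "((\<lambda>y. 0) has_derivative (\<lambda>h. 0 \<bullet> h)) (at x)" by simp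
  ultimately have "(f has_derivative (\<lambda>h. 0 \<bullet> h)) (at x)"
    using assms by (elim has_derivative_transform_within_open[where s="{x. norm x > r}"]) auto
  then show ?thesis using gradient_eqI(2) by fastforce
qed

text \<open>Differentiation under the integral sign asks for one domain that serves all nearby
  \<open>x\<close>: a box containing the balls of radius \<open>r\<close> about all points of
  \<open>ball x0 1\<close>.\<close>

lemma has_derivative_mollify:
  fixes u :: "real^'n::finite \<Rightarrow> real"
  assumes \<rho>: "k_smooth 1 \<rho>" "\<And>x. norm x > r \<Longrightarrow> \<rho> x = 0" and u: "continuous_on UNIV u"
  shows "(mollify \<rho> u has_derivative (\<lambda>h. (\<chi> i. mollify (partial_deriv i \<rho>) u x0) \<bullet> h)) (at x0)"
proof -
  have "bounded (cball x0 (1 + r))" by simp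
  then obtain a b where ab: "cball x0 (1 + r) \<subseteq> cbox a b"
    using bounded_subset_cbox_symmetric by metis
  have sub: "cball x r \<subseteq> cbox a b" if "x \<in> ball x0 1" for x
  proof -
    have "cball x r \<subseteq> cball x0 (1 + r)"
    proof
      fix y assume "y \<in> cball x r"
      then show "y \<in> cball x0 (1 + r)"
        using that dist_triangle[of x0 y x] by auto
    qed
    then show ?thesis using ab by blast
  qed
  have c: "continuous_on UNIV \<rho>" using k_smooth_continuous \<rho>(1) by blast
  have cg: "continuous_on UNIV (gradient \<rho>)" using \<rho>(1) by (rule continuous_on_gradient)
  have cp: "continuous_on UNIV (partial_deriv i \<rho>)" for i
    using \<rho>(1) by simp
  note M = mollify_eq_integral[where r=r, OF c \<rho>(2) u]
  note MP = mollify_eq_integral[where r=r, OF cp partial_deriv_vanishes[where r=r, OF \<rho>(2)] u]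
  \<comment> \<open>The derivative of the integrand as a bounded linear map, the form in which
    \<open>leibniz_rule\<close> integrates it.\<close>
  define D where "D x y = u y *\<^sub>R blinfun_inner_right (gradient \<rho> (x - y))" for x y
  have "((\<lambda>x. integral (cbox a b) (\<lambda>y. \<rho> (x - y) * u y)) has_derivative integral (cbox a b) (D x0))
    (at x0 within ball x0 1)"
  proof (rule leibniz_rule)
    fix x y assume "x \<in> ball x0 1" "y \<in> cbox a b"
    have "((\<lambda>x. \<rho> (x - y)) has_derivative (\<lambda>h. gradient \<rho> (x - y) \<bullet> h)) (at x)"
      by (rule has_derivative_compose[where f="\<lambda>x. x - y" and f'="\<lambda>h. h", OF _ has_derivative_gradient])
        (use \<rho>(1) in \<open>auto intro!: derivative_eq_intros\<close>)
    then have "((\<lambda>x. \<rho> (x - y) * u y) has_derivative (\<lambda>h. (gradient \<rho> (x - y) \<bullet> h) * u y)) (at x)"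
      by (rule has_derivative_mult_left)
    moreover have "(\<lambda>h. (gradient \<rho> (x - y) \<bullet> h) * u y) = blinfun_apply (D x y)"
      by (auto simp: D_def scaleR_blinfun.rep_eq)
    ultimately show "((\<lambda>x. \<rho> (x - y) * u y) has_derivative blinfun_apply (D x y)) (at x within ball x0 1)"
      using has_derivative_at_withinI by metis
  next
    show "continuous_on (ball x0 1 \<times> cbox a b) (\<lambda>(x, t). D x t)"
      unfolding D_def split_beta'
      by (intro continuous_intros continuous_on_compose2[OF u]
          bounded_linear.continuous_on[OF bounded_linear_blinfun_inner_right]
          continuous_on_compose2[OF cg]) auto
  qed (use M(1) sub in auto)
  then have "((\<lambda>x. integral (cbox a b) (\<lambda>y. \<rho> (x - y) * u y)) has_derivative integral (cbox a b) (D x0)) (at x0)"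
    by (subst (asm) at_within_open) auto
  then have *: "(mollify \<rho> u has_derivative integral (cbox a b) (D x0)) (at x0)"
    by (rule has_derivative_transform_within_open[where s="ball x0 1"]) (auto intro!: M(2)[symmetric] sub)
  have D: "D x0 integrable_on cbox a b"
    unfolding D_def
    by (intro integrable_continuous continuous_intros continuous_on_subset[OF u]
          bounded_linear.continuous_on[OF bounded_linear_blinfun_inner_right]
          continuous_on_compose2[OF cg]) auto
  have "blinfun_apply (integral (cbox a b) (D x0)) h
    = (\<chi> i. mollify (partial_deriv i \<rho>) u x0) \<bullet> h" for h
  proof -
    have "blinfun_apply (integral (cbox a b) (D x0)) h = integral (cbox a b) (\<lambda>y. D x0 y h)"
      by (rule blinfun_apply_integral[OF D])
    also have "\<dots> = integral (cbox a b) (\<lambda>y. \<Sum>i\<in>UNIV. partial_deriv i \<rho> (x0 - y) * u y * h $ i)"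
      by (simp add: D_def scaleR_blinfun.rep_eq inner_vec_def gradient_def sum_distrib_left mult_ac)
    also have "\<dots> = (\<Sum>i\<in>UNIV. integral (cbox a b) (\<lambda>y. partial_deriv i \<rho> (x0 - y) * u y * h $ i))"
      using MP(1) sub by (intro integral_sum integrable_on_mult_left) auto
    also have "\<dots> = (\<Sum>i\<in>UNIV. mollify (partial_deriv i \<rho>) u x0 * h $ i)"
      using sub[of x0] by (intro sum.cong refl) (simp add: MP(2))
    finally show ?thesis by (simp add: inner_vec_def)
  qed
  then have "blinfun_apply (integral (cbox a b) (D x0)) = (\<lambda>h. (\<chi> i. mollify (partial_deriv i \<rho>) u x0) \<bullet> h)"
    by auto
  then show ?thesis using * by simp
qed

text \<open>The partial derivatives of a mollification are mollifications by the partial derivatives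
  of the kernel, so the induction varies \<rho>. Partial derivatives lose sign and mass, which is
  why \<rho> is described by smoothness and support instead of by \<open>mollifier\<close>.\<close>

lemma k_smooth_mollify:
  fixes u :: "real^'n::finite \<Rightarrow> real"
  assumes "\<And>j. k_smooth j \<rho>" "\<And>x. norm x > r \<Longrightarrow> \<rho> x = 0" and u: "continuous_on UNIV u"
  shows "k_smooth k (mollify \<rho> u)"
  using assms(1,2)
proof (induction k arbitrary: \<rho>)
  case 0
  show ?case
    using has_derivative_continuous[OF has_derivative_mollify[where r=r, OF 0 u]]
    by (simp add: continuous_on_eq_continuous_at)
next
  case (Suc k)
  show ?case
  proof (rule k_smooth_SucI[OF has_derivative_mollify[where r=r, OF Suc.prems u]])
    have "k_smooth j (partial_deriv i \<rho>)" for i j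
      using Suc.prems(1)[of "Suc j"] by simp
    then show "k_smooth k (\<lambda>x. (\<chi> i. mollify (partial_deriv i \<rho>) u x) $ i)" for i
      using Suc.IH[of "partial_deriv i \<rho>", OF _ partial_deriv_vanishes[where r=r, OF Suc.prems(2)]] by simp
  qed
qed

text \<open>The weak gradient identity is tested with the function of y given by \<rho>(x - y). Its
  reflection and the integration by parts each contribute a minus sign, so the gradient passes from
  the kernel to \<open>G\<close>.\<close>

lemma gradient_mollify:
  fixes u :: "real^'n::finite \<Rightarrow> real" and G :: "real^'n \<Rightarrow> real^'n"
  assumes \<rho>: "\<And>j. k_smooth j \<rho>" "\<And>x. norm x > r \<Longrightarrow> \<rho> x = 0" and u: "continuous_on UNIV u"
    and G: "loc_integrable G"
    and W: "\<And>\<zeta> i. \<zeta> \<in> test_functions \<Longrightarrow>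
      (\<integral>x. u x * partial_deriv i \<zeta> x \<partial>lborel) = - (\<integral>x. G x $ i * \<zeta> x \<partial>lborel)"
  shows "gradient (mollify \<rho> u) x = mollify \<rho> G x"
proof -
  have "mollify (partial_deriv i \<rho>) u x = mollify \<rho> G x $ i" for i
  proof -
    define \<zeta> where "\<zeta> y = \<rho> (x + (-1) *\<^sub>R y)" for y
    have \<zeta>: "\<zeta> \<in> test_functions"
      unfolding \<zeta>_def
      by (rule test_functionsI[where c=x and r=r])
        (auto intro!: \<rho>(2) k_smooth_affine[OF \<rho>(1), of _ x "-1", simplified] simp: norm_minus_commute)
    have "gradient \<zeta> y = - gradient \<rho> (x - y)" for y
      unfolding \<zeta>_def using gradient_affine[OF \<rho>(1), of x "-1" y] by simp
    then have d: "partial_deriv i \<zeta> y = - partial_deriv i \<rho> (x - y)" for y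
      by (simp add: gradient_def vec_eq_iff)
    have "mollify (partial_deriv i \<rho>) u x = - (\<integral>y. u y * partial_deriv i \<zeta> y \<partial>lborel)"
      by (simp add: mollify_def d mult.commute)
    also have "\<dots> = (\<integral>y. G y $ i * \<zeta> y \<partial>lborel)" using W[OF \<zeta>] by simp
    also have "\<dots> = (\<integral>y. (\<rho> (x - y) *\<^sub>R G y) $ i \<partial>lborel)" by (simp add: \<zeta>_def mult.commute)
    also have "\<dots> = mollify \<rho> G x $ i"
      unfolding mollify_def
      by (rule integral_bounded_linear[OF bounded_linear_vec_nth])
        (rule integrable_kernel[OF G k_smooth_continuous[OF \<rho>(1)] \<rho>(2)])
    finally show ?thesis .
  qed
  then show ?thesis
    using gradient_eqI(1)[OF has_derivative_mollify[where r=r, OF \<rho> u], of x] by (simp add: vec_eq_iff)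
qed

text \<open>A rescaled cutoff divided by its integral, which is positive because the cutoff equals 1
  on the ball of radius \<open>r/2\<close>.\<close>

lemma mollifier_exists:
  assumes "r > 0"
  obtains \<rho> :: "real^'n::finite \<Rightarrow> real" where "mollifier r \<rho>" "\<And>k. k_smooth k \<rho>"
proof -
  obtain \<eta> :: "real^'n \<Rightarrow> real" where sm: "\<And>k. k_smooth k \<eta>" and \<eta>: "\<And>x. 0 \<le> \<eta> x"
    "\<And>x. norm x \<le> 1 \<Longrightarrow> \<eta> x = 1" "\<And>x. norm x > 2 \<Longrightarrow> \<eta> x = 0" "\<And>x. \<eta> (- x) = \<eta> x"
    by (rule cutoff_exists) blast
  define \<phi> where "\<phi> x = \<eta> ((2/r) *\<^sub>R x)" for x
  have sm\<phi>: "k_smooth k \<phi>" for k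
    unfolding \<phi>_def using k_smooth_affine[OF sm, of k 0 "2/r"] by simp
  then have c: "continuous_on UNIV \<phi>" using k_smooth_continuous by blast
  have 0: "\<phi> x = 0" if "norm x > r" for x
    unfolding \<phi>_def by (rule \<eta>(3)) (use that assms in \<open>simp add: field_simps\<close>)
  have 1: "\<phi> x = 1" if "norm x \<le> r/2" for x
    unfolding \<phi>_def by (rule \<eta>(2)) (use that assms in \<open>simp add: field_simps\<close>)
  have "integrable lborel (\<lambda>x. indicator (cball 0 r) x *\<^sub>R \<phi> x)"
    by (intro borel_integrable_compact continuous_on_subset[OF c]) auto
  also have "(\<lambda>x. indicator (cball 0 r) x *\<^sub>R \<phi> x) = \<phi>"
    using 0 by (auto simp: indicator_def fun_eq_iff not_le)
  finally have i: "integrable lborel \<phi>" .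
  have "0 < measure lborel (cball (0::real^'n) (r/2))"
    using content_cball_pos[of "r/2" "0::real^'n"] assms by simp
  also have "measure lborel (cball (0::real^'n) (r/2)) = (\<integral>x. indicator (cball (0::real^'n) (r/2)) x \<partial>lborel)"
    by simp
  also have "\<dots> \<le> integral\<^sup>L lborel \<phi>"
  proof (rule integral_mono[OF _ i])
    show "integrable lborel (indicat_real (cball (0::real^'n) (r/2)))"
      using emeasure_lborel_cball_finite[of "0::real^'n" "r/2"] by (simp add: integrable_indicator_iff)
    show "indicator (cball 0 (r/2)) x \<le> \<phi> x" for x
      using 1[of x] \<eta>(1) by (auto simp: indicator_def \<phi>_def)
  qed
  finally have pos: "integral\<^sup>L lborel \<phi> > 0" .
  show thesis
  proof
    show "mollifier r (\<lambda>x. (1 / integral\<^sup>L lborel \<phi>) * \<phi> x)"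
      unfolding mollifier_def using pos 0 \<eta>(1,4)
      by (auto simp: continuous_on_mult_left[OF c] intro!: continuous_intros c) (auto simp: \<phi>_def)
    show "k_smooth k (\<lambda>x. (1 / integral\<^sup>L lborel \<phi>) * \<phi> x)" for k
      by (intro k_smooth_cmult sm\<phi>)
  qed
qed

section \<open>Logarithmic energy of supersolutions\<close>

text \<open>The argument of Riesz and Fischer: the sum of all errors has finite integral, so it is
  finite almost everywhere. There the errors tend to 0, and the sum itself bounds each of
  them.\<close>

lemma L1_fast_convergence:
  fixes s :: "nat \<Rightarrow> 'a \<Rightarrow> 'b::euclidean_space"
  assumes [measurable]: "\<And>k. s k \<in> borel_measurable M" "f \<in> borel_measurable M"
    and le: "\<And>k. (\<integral>\<^sup>+x. norm (s k x - f x) \<partial>M) \<le> ennreal ((1/2) ^ k)"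
  obtains h where "integrable M h" "\<And>x. 0 \<le> h x"
    "AE x in M. (\<forall>k. norm (s k x - f x) \<le> h x) \<and> (\<lambda>k. s k x) \<longlonglongrightarrow> f x"
proof -
  define H where "H x = (\<Sum>k. ennreal (norm (s k x - f x)))" for x
  have [measurable]: "H \<in> borel_measurable M" unfolding H_def by measurable
  have "(\<integral>\<^sup>+x. H x \<partial>M) = (\<Sum>k. \<integral>\<^sup>+x. norm (s k x - f x) \<partial>M)"
    unfolding H_def by (rule nn_integral_suminf) measurable
  also have "\<dots> \<le> (\<Sum>k. ennreal ((1/2) ^ k))"
    by (intro suminf_le le) auto
  also have "\<dots> = ennreal (\<Sum>k. (1/2) ^ k)"
    by (intro suminf_ennreal2) (auto intro: summable_geometric)
  finally have fin: "(\<integral>\<^sup>+x. H x \<partial>M) < \<infinity>"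
    using le_less_trans by fastforce
  then have ae: "AE x in M. H x \<noteq> \<infinity>"
    by (intro nn_integral_PInf_AE) auto
  have bd: "norm (s k x - f x) \<le> enn2real (H x) \<and> (\<lambda>k. s k x) \<longlonglongrightarrow> f x" if "H x \<noteq> \<infinity>" for x k
  proof -
    have top: "(\<Sum>k. ennreal (norm (s k x - f x))) \<noteq> top"
      using that by (simp add: H_def)
    have sm: "summable (\<lambda>k. norm (s k x - f x))"
      using summable_suminf_not_top[OF _ top] by simp
    have "H x = ennreal (\<Sum>k. norm (s k x - f x))"
      unfolding H_def by (rule suminf_ennreal[OF _ top]) simp
    then have "enn2real (H x) = (\<Sum>k. norm (s k x - f x))"
      by (simp add: suminf_nonneg[OF sm])
    moreover have "norm (s k x - f x) \<le> (\<Sum>k. norm (s k x - f x))"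
      using sum_le_suminf[OF sm, of "{k}"] by simp
    moreover have "(\<lambda>k. s k x) \<longlonglongrightarrow> f x"
      using summable_LIMSEQ_zero[OF sm] by (simp add: LIM_zero_iff tendsto_norm_zero_iff)
    ultimately show ?thesis by simp
  qed
  \<comment> \<open>The dominating function \<open>enn2real (H x)\<close> is 0 where
    \<open>H\<close> is infinite; that set is null.\<close>
  show thesis
  proof (rule that)
    have "(\<integral>\<^sup>+x. ennreal (enn2real (H x)) \<partial>M) = (\<integral>\<^sup>+x. H x \<partial>M)"
      using ae by (intro nn_integral_cong_AE) (auto elim!: eventually_mono simp: less_top)
    then show "integrable M (\<lambda>x. enn2real (H x))"
      using fin by (intro integrableI_nonneg) auto
    show "AE x in M. (\<forall>k. norm (s k x - f x) \<le> enn2real (H x)) \<and> (\<lambda>k. s k x) \<longlonglongrightarrow> f x"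
      using ae bd by (auto elim!: eventually_mono)
  qed simp
qed

lemma mollify_between:
  fixes u :: "'a::euclidean_space \<Rightarrow> real"
  assumes "loc_integrable u" "mollifier r \<rho>"
    and "\<And>y. norm (y - x) \<le> r \<Longrightarrow> m \<le> u y \<and> u y \<le> B"
  shows "m \<le> mollify \<rho> u x"
proof -
  \<comment> \<open>\<open>u\<close> stays in the ball of radius \<open>(B - m) / 2\<close> around the midpoint of \<open>[m, B]\<close>.\<close>
  have "norm (mollify \<rho> u x - (m + B) / 2) \<le> (B - m) / 2"
  proof (rule mollify_near[OF assms(1,2)])
    fix y assume "norm (y - x) \<le> r"
    from assms(3)[OF this] show "norm (u y - (m + B) / 2) \<le> (B - m) / 2"
      by (auto simp: abs_le_iff field_simps)
  qed
  then show ?thesis by (simp add: abs_le_iff field_simps)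
qed

lemma mollify_lower_bound:
  fixes u :: "'a::euclidean_space \<Rightarrow> real"
  assumes u: "continuous_on UNIV u" and \<rho>: "mollifier r \<rho>"
    and m: "\<And>y. norm (y - x) \<le> r \<Longrightarrow> m \<le> u y"
  shows "m \<le> mollify \<rho> u x"
proof -
  have "bounded (u ` cball x r)"
    by (intro compact_imp_bounded compact_continuous_image continuous_on_subset[OF u]) auto
  then obtain B where "\<And>y. y \<in> cball x r \<Longrightarrow> \<bar>u y\<bar> \<le> B"
    unfolding bounded_iff by (metis imageI real_norm_def)
  then show ?thesis
    using mollify_between[OF continuous_loc_integrable[OF u] \<rho>, of x m B] m
    by (force simp: dist_norm norm_minus_commute)
qed

lemma mollify_pos:
  fixes u :: "'a::euclidean_space \<Rightarrow> real"
  assumes u: "continuous_on UNIV u" "\<And>x. u x > 0" and \<rho>: "mollifier r \<rho>" and "r > 0"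
  shows "mollify \<rho> u x > 0"
proof -
  have "\<exists>z\<in>cball x r. \<forall>y\<in>cball x r. u z \<le> u y"
    by (rule continuous_attains_inf) (use \<open>r > 0\<close> continuous_on_subset[OF u(1)] in auto)
  then obtain z where "\<And>y. y \<in> cball x r \<Longrightarrow> u z \<le> u y" by blast
  then have "u z \<le> mollify \<rho> u x"
    by (intro mollify_lower_bound[OF u(1) \<rho>]) (auto simp: dist_norm norm_minus_commute)
  then show ?thesis using u(2)[of z] by simp
qed

lemma mollify_tendsto:
  fixes u :: "'a::euclidean_space \<Rightarrow> 'b::euclidean_space"
  assumes u: "continuous_on UNIV u" and \<rho>: "\<And>k. mollifier (r k) (\<rho> k)" and r: "r \<longlonglongrightarrow> 0"
  shows "(\<lambda>k. mollify (\<rho> k) u x) \<longlonglongrightarrow> u x"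
proof (rule metric_LIMSEQ_I)
  fix e :: real assume "e > 0"
  have "isCont u x" using u by (simp add: continuous_on_eq_continuous_at)
  then obtain d where d: "d > 0" "\<And>y. dist y x < d \<Longrightarrow> dist (u y) (u x) < e/2"
    unfolding continuous_at_eps_delta using \<open>e > 0\<close> by (meson half_gt_zero)
  have "\<forall>\<^sub>F k in sequentially. r k < d" using r d(1) by (rule order_tendstoD)
  then obtain K where K: "\<And>k. k \<ge> K \<Longrightarrow> r k < d" by (auto simp: eventually_sequentially)
  have "dist (mollify (\<rho> k) u x) (u x) < e" if "k \<ge> K" for k
  proof -
    have "norm (mollify (\<rho> k) u x - u x) \<le> e/2"
      by (rule mollify_near[OF continuous_loc_integrable[OF u] \<rho>])
        (metis K[OF that] d(2) dist_norm le_less_trans less_imp_le)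
    then show ?thesis using \<open>e > 0\<close> by (simp add: dist_norm)
  qed
  then show "\<exists>K. \<forall>k\<ge>K. dist (mollify (\<rho> k) u x) (u x) < e" by blast
qed

text \<open>The \<open>p\<close>-th power of the larger of \<open>a\<close> and \<open>b\<close>
  already dominates the product.\<close>

lemma powr_pred_mult_le:
  fixes a b p :: real
  assumes "p > 1" "a \<ge> 0" "b \<ge> 0"
  shows "a powr (p - 1) * b \<le> a powr p + b powr p"
proof (cases "a = 0 \<or> b = 0")
  case False
  then have ab: "a > 0" "b > 0" using assms by auto
  have e: "x powr (p - 1) * x = x powr p" if "x > 0" for x
    using powr_add[of x "p - 1" 1] that by simp
  show ?thesis
  proof (cases "a \<le> b")
    case True
    then have "a powr (p - 1) * b \<le> b powr (p - 1) * b"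
      using ab assms by (intro mult_right_mono powr_mono2) auto
    then show ?thesis using e[OF ab(2)] powr_ge_zero[of a p] by linarith
  next
    case False
    then have "a powr (p - 1) * b \<le> a powr (p - 1) * a"
      by (intro mult_left_mono) auto
    then show ?thesis using e[OF ab(1)] powr_ge_zero[of b p] by linarith
  qed
qed (use assms in auto)

text \<open>Young's inequality is applied under the kernel average with \<open>a\<close> fixed, so
  the power \<open>p\<close> falls on \<open>norm (G y)\<close> before averaging. Products of the
  flux with the mollified gradient are thereby dominated through mollifications of a locally
  integrable function.\<close>

lemma mollify_young:
  fixes G :: "'a::euclidean_space \<Rightarrow> 'b::euclidean_space"
  assumes G: "loc_integrable G" and Gp: "loc_integrable (\<lambda>x. norm (G x) powr p)"
    and \<rho>: "mollifier r \<rho>" and "p > 1" "a \<ge> 0"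
  shows "a powr (p - 1) * norm (mollify \<rho> G x) \<le> a powr p + mollify \<rho> (\<lambda>x. norm (G x) powr p) x"
proof -
  note \<rho>D = mollifierD[OF \<rho>]
  have i1: "integrable lborel (\<lambda>y. norm (\<rho> (x - y) *\<^sub>R G y))"
    by (intro integrable_norm integrable_kernel[OF G \<rho>D(1,5)])
  have i2: "integrable lborel (\<lambda>y. \<rho> (x - y) *\<^sub>R norm (G y) powr p)"
    by (intro integrable_kernel[OF Gp \<rho>D(1,5)])
  have "a powr (p - 1) * norm (mollify \<rho> G x)
      \<le> a powr (p - 1) * (\<integral>y. norm (\<rho> (x - y) *\<^sub>R G y) \<partial>lborel)"
    unfolding mollify_def by (intro mult_left_mono integral_norm_bound) auto
  also have "\<dots> = (\<integral>y. a powr (p - 1) * norm (\<rho> (x - y) *\<^sub>R G y) \<partial>lborel)"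
    by simp
  also have "\<dots> \<le> (\<integral>y. \<rho> (x - y) * a powr p + \<rho> (x - y) *\<^sub>R norm (G y) powr p \<partial>lborel)"
  proof (rule integral_mono)
    show "integrable lborel (\<lambda>y. a powr (p - 1) * norm (\<rho> (x - y) *\<^sub>R G y))"
      using i1 by (rule integrable_mult_right)
    show "integrable lborel (\<lambda>y. \<rho> (x - y) * a powr p + \<rho> (x - y) *\<^sub>R norm (G y) powr p)"
      by (intro Bochner_Integration.integrable_add i2 integrable_mult_left \<rho>D)
    fix y
    have "\<rho> (x - y) * (a powr (p - 1) * norm (G y)) \<le> \<rho> (x - y) * (a powr p + norm (G y) powr p)"
      using powr_pred_mult_le[of p a "norm (G y)"] assms(4,5) \<rho>D(3) by (intro mult_left_mono) auto
    then show "a powr (p - 1) * norm (\<rho> (x - y) *\<^sub>R G y) \<le> \<rho> (x - y) * a powr p + \<rho> (x - y) *\<^sub>R norm (G y) powr p"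
      using \<rho>D(3)[of "x - y"] by (simp add: algebra_simps)
  qed
  also have "\<dots> = a powr p + mollify \<rho> (\<lambda>x. norm (G x) powr p) x"
    using i2 \<rho>D(9,10) by (subst Bochner_Integration.integral_add) (auto simp: mollify_def)
  finally show ?thesis .
qed

section \<open>Integral estimates for supersolutions\<close>

lemma gradient_vanishes:
  fixes f :: "real^'n::finite \<Rightarrow> real"
  assumes "\<And>x. norm x > r \<Longrightarrow> f x = 0" "norm x > r"
  shows "gradient f x = 0"
  using partial_deriv_vanishes[of r f, OF assms] by (simp add: gradient_def vec_eq_iff)

text \<open>\<open>V\<close> stands for a Borel version of the flux A(x, G(x)), and the equation is
  kept as the weak inequality -div V \<ge> 0. The strength of the source returns only in
  \<open>no_global_flux\<close>, as a lower bound on the flux.\<close>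

locale supersolution =
  fixes p \<mu>1 \<mu> :: real and u :: "real^'n::finite \<Rightarrow> real" and G V :: "real^'n \<Rightarrow> real^'n"
  assumes p: "p > 1" and u: "continuous_on UNIV u" "\<And>x. u x > 0"
    and G: "loc_integrable G" and Gp: "loc_integrable (\<lambda>x. norm (G x) powr p)"
    and W: "\<And>\<zeta> i. \<zeta> \<in> test_functions \<Longrightarrow>
      (\<integral>x. u x * partial_deriv i \<zeta> x \<partial>lborel) = - (\<integral>x. G x $ i * \<zeta> x \<partial>lborel)"
    and V: "V \<in> borel_measurable borel"
    and coercive: "AE x in lborel. \<mu>1 * norm (G x) powr p \<le> V x \<bullet> G x" and \<mu>1: "\<mu>1 > 0"
    and VG: "AE x in lborel. norm (V x) \<le> \<mu> * norm (G x) powr (p - 1)" and \<mu>: "\<mu> > 0"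
    and super: "\<And>\<zeta>. \<zeta> \<in> test_functions \<Longrightarrow> (\<And>x. \<zeta> x \<ge> 0) \<Longrightarrow> 0 \<le> (\<integral>x. V x \<bullet> gradient \<zeta> x \<partial>lborel)"
begin

text \<open>\<open>F\<close> is the flux against the formal gradient of \<eta>^2 u^(1-p). With the
  mollified \<open>U k\<close> in place of \<open>u\<close> the test function is admissible and the
  integral nonnegative, and this sign survives the limit.\<close>

lemma weighted_gradient_test:
  fixes \<eta> :: "real^'n \<Rightarrow> real"
  assumes \<eta>: "\<And>k. k_smooth k \<eta>" "\<And>x. 0 \<le> \<eta> x" "\<And>x. \<eta> x \<le> 1" "\<And>x. norm x > R \<Longrightarrow> \<eta> x = 0"
    and D: "\<And>x. norm (gradient \<eta> x) \<le> D"
  defines "F \<equiv> \<lambda>x. V x \<bullet> ((2 * \<eta> x * u x powr (1 - p)) *\<^sub>R gradient \<eta> x + ((1 - p) * (\<eta> x)\<^sup>2 * u x powr (- p)) *\<^sub>R G x)"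
  shows "integrable lborel F" "0 \<le> integral\<^sup>L lborel F"
proof -
  let ?K = "cball (0::real^'n) R"
  let ?g = "\<lambda>x. norm (G x) powr p"
  have [measurable]: "?K \<in> sets lborel" by simp
  note [measurable] = V
  have um[measurable]: "u \<in> borel_measurable borel" using u(1) by (rule borel_measurable_continuous_onI)
  have Gm[measurable]: "G \<in> borel_measurable borel" using G by (simp add: loc_integrable_def)
  have [measurable]: "\<eta> \<in> borel_measurable borel"
    using k_smooth_continuous[OF \<eta>(1)] by (rule borel_measurable_continuous_onI)
  have [measurable]: "gradient \<eta> \<in> borel_measurable borel"
    using continuous_on_gradient[OF \<eta>(1)] by (rule borel_measurable_continuous_onI)
  \<comment> \<open>Both L^1 errors are at most 2^(-k), so that \<open>L1_fast_convergence\<close>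
    applies to \<open>G\<close> and to the p-th power of its norm. The radius tends to 0 and is at
    most 1, so on the ball of radius \<open>R\<close> the function \<open>U k\<close> sees only
    \<open>cball 0 (R + 1)\<close>.\<close>
  define P where "P k r \<rho> \<longleftrightarrow> 0 < r \<and> r \<le> 1 / Suc k \<and> mollifier r \<rho> \<and> (\<forall>j. k_smooth j \<rho>) \<and>
     (\<integral>\<^sup>+x\<in>?K. norm (mollify \<rho> G x - G x) \<partial>lborel) \<le> ennreal ((1/2)^k) \<and>
     (\<integral>\<^sup>+x\<in>?K. norm (mollify \<rho> ?g x - ?g x) \<partial>lborel) \<le> ennreal ((1/2)^k)" for k :: nat and r \<rho>
  have "\<exists>r \<rho>. P k r \<rho>" for k
  proof -
    obtain d1 where d1: "d1 > 0" "\<And>r \<rho>. mollifier r \<rho> \<Longrightarrow> r \<le> d1 \<Longrightarrow>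
      (\<integral>\<^sup>+x\<in>?K. norm (mollify \<rho> G x - G x) \<partial>lborel) \<le> ennreal ((1/2)^k)"
      using mollify_L1[OF G, of "(1/2)^k" R] by auto
    obtain d2 where d2: "d2 > 0" "\<And>r \<rho>. mollifier r \<rho> \<Longrightarrow> r \<le> d2 \<Longrightarrow>
      (\<integral>\<^sup>+x\<in>?K. norm (mollify \<rho> ?g x - ?g x) \<partial>lborel) \<le> ennreal ((1/2)^k)"
      using mollify_L1[OF Gp, of "(1/2)^k" R] by auto
    define r where "r = min (1 / Suc k) (min d1 d2)"
    have "r > 0" using d1 d2 by (simp add: r_def)
    obtain \<rho> :: "real^'n \<Rightarrow> real" where "mollifier r \<rho>" "\<And>j. k_smooth j \<rho>"
      using mollifier_exists[OF \<open>r > 0\<close>] by blast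
    with d1 d2 \<open>r > 0\<close> show ?thesis
      by (intro exI[of _ r] exI[of _ \<rho>]) (auto simp: r_def P_def)
  qed
  then obtain r \<rho> where P: "\<And>k. P k (r k) (\<rho> k)" by metis
  then have r: "\<And>k. 0 < r k" "\<And>k. r k \<le> 1 / Suc k" and \<rho>: "\<And>k::nat. mollifier (r k) (\<rho> k)"
    and sm: "\<And>k j. k_smooth j (\<rho> k)"
    and L1: "\<And>k. (\<integral>\<^sup>+x\<in>?K. norm (mollify (\<rho> k) G x - G x) \<partial>lborel) \<le> ennreal ((1/2)^k)"
    and L2: "\<And>k. (\<integral>\<^sup>+x\<in>?K. norm (mollify (\<rho> k) ?g x - ?g x) \<partial>lborel) \<le> ennreal ((1/2)^k)"
    unfolding P_def by blast+
  have r0: "r \<longlonglongrightarrow> 0"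
    by (rule tendsto_sandwich[OF _ _ tendsto_const LIMSEQ_inverse_real_of_nat])
      (use r in \<open>auto simp: less_imp_le inverse_eq_divide\<close>)
  have r1: "r k \<le> 1" for k
    using r(2)[of k] by (rule order_trans) (simp add: field_simps)
  note \<rho>D = mollifierD[OF \<rho>]
  define U where "U k = mollify (\<rho> k) u" for k
  define GG where "GG k = mollify (\<rho> k) G" for k
  define gg where "gg k = mollify (\<rho> k) ?g" for k
  have [measurable]: "U k \<in> borel_measurable borel" "GG k \<in> borel_measurable borel" "gg k \<in> borel_measurable borel" for k
    unfolding U_def GG_def gg_def by (intro measurable_mollify \<rho>D(1); measurable)+
  have U: "U k x > 0" for k x
    unfolding U_def by (rule mollify_pos[OF u \<rho> r(1)])
  have Usm: "k_smooth j (U k)" for j k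
    unfolding U_def by (rule k_smooth_mollify[OF sm \<rho>D(5) u(1)])
  have Ugrad: "gradient (U k) x = GG k x" for k x
    unfolding U_def GG_def by (rule gradient_mollify[OF sm \<rho>D(5) u(1) G W])
  have Ulim: "(\<lambda>k. U k x) \<longlonglongrightarrow> u x" for x
    unfolding U_def by (rule mollify_tendsto[OF u(1) \<rho> r0])
  \<comment> \<open>Negative powers of \<open>U k\<close> will be bounded by powers of
    \<open>m\<close>. For an empty ball any positive number serves.\<close>
  have "\<exists>m>0. \<forall>y\<in>cball 0 (R + 1). m \<le> u y"
  proof (cases "cball (0::real^'n) (R + 1) = {}")
    case False
    then have "\<exists>z\<in>cball 0 (R + 1). \<forall>y\<in>cball 0 (R + 1). u z \<le> u y"
      by (intro continuous_attains_inf continuous_on_subset[OF u(1)]) auto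
    then show ?thesis using u(2) by blast
  next
    case True
    then show ?thesis by (intro exI[of _ 1]) auto
  qed
  then obtain m where m: "m > 0" "\<And>y. norm y \<le> R + 1 \<Longrightarrow> m \<le> u y" by auto
  have mU: "m \<le> U k x" if "norm x \<le> R" for k x
    unfolding U_def
  proof (rule mollify_lower_bound[OF u(1) \<rho>])
    fix y assume "norm (y - x) \<le> r k"
    then show "m \<le> u y" using r1[of k] that norm_triangle_sub[of y x] by (intro m(2)) auto
  qed
  define F' where "F' k x = V x \<bullet> ((2 * \<eta> x * U k x powr (1 - p)) *\<^sub>R gradient \<eta> x
      + ((1 - p) * (\<eta> x)\<^sup>2 * U k x powr (- p)) *\<^sub>R GG k x)" for k x
  have [measurable]: "F' k \<in> borel_measurable borel" "F \<in> borel_measurable borel" for k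
    unfolding F'_def F_def by measurable
  have nonneg: "0 \<le> integral\<^sup>L lborel (F' k)" for k
  proof -
    define \<zeta> where "\<zeta> x = (\<eta> x * \<eta> x) * U k x powr (1 - p)" for x
    have "\<zeta> \<in> test_functions"
      unfolding \<zeta>_def
      by (rule test_functionsI[where c=0 and r=R])
        (auto intro!: k_smooth_mult \<eta> k_smooth_powr U Usm)
    moreover have "\<zeta> x \<ge> 0" for x using \<eta>(2) by (simp add: \<zeta>_def)
    moreover have "gradient \<zeta> x = (2 * \<eta> x * U k x powr (1 - p)) *\<^sub>R gradient \<eta> x
      + ((1 - p) * (\<eta> x)\<^sup>2 * U k x powr (- p)) *\<^sub>R GG k x" for x
    proof (rule gradient_eqI)
      note d\<eta> = k_smooth_Suc_deriv(1)[OF \<eta>(1), of x]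
      note dU = k_smooth_Suc_deriv(1)[OF Usm, of k x, unfolded Ugrad]
      have dp: "((\<lambda>t. t powr (1 - p)) has_derivative (\<lambda>h. (1 - p) * U k x powr (- p) * h)) (at (U k x))"
        using has_real_derivative_powr[OF U, of "1 - p" k x] by (simp add: has_field_derivative_def)
      show "(\<zeta> has_derivative (\<lambda>h. ((2 * \<eta> x * U k x powr (1 - p)) *\<^sub>R gradient \<eta> x
        + ((1 - p) * (\<eta> x)\<^sup>2 * U k x powr (- p)) *\<^sub>R GG k x) \<bullet> h)) (at x)"
        unfolding \<zeta>_def
        by (rule has_derivative_eq_rhs[OF has_derivative_mult[OF has_derivative_mult[OF d\<eta> d\<eta>]
              has_derivative_compose[OF dU dp]]])
          (auto simp: fun_eq_iff inner_add_left power2_eq_square algebra_simps)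
    qed
    ultimately show ?thesis using super[of \<zeta>] by (simp add: F'_def[abs_def])
  qed
  \<comment> \<open>For \<open>GG\<close> the almost everywhere limit is what matters below, for
    \<open>gg\<close> the dominating function \<open>h\<close>.\<close>
  obtain h1 where h1: "AE x in lborel. (\<forall>k. norm (indicator ?K x *\<^sub>R GG k x - indicator ?K x *\<^sub>R G x) \<le> h1 x)
      \<and> (\<lambda>k. indicator ?K x *\<^sub>R GG k x) \<longlonglongrightarrow> indicator ?K x *\<^sub>R G x"
  proof (rule L1_fast_convergence[where s="\<lambda>k x. indicator ?K x *\<^sub>R GG k x" and f="\<lambda>x. indicator ?K x *\<^sub>R G x" and M=lborel])
    show "(\<integral>\<^sup>+ x. ennreal (norm (indicator ?K x *\<^sub>R GG k x - indicator ?K x *\<^sub>R G x)) \<partial>lborel) \<le> ennreal ((1/2)^k)" for k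
      using L1[of k] unfolding GG_def
      by (rule order_trans[rotated]) (auto intro!: nn_integral_mono simp: indicator_def)
  qed (use that in auto)
  obtain h where h: "integrable lborel h" "\<And>x. 0 \<le> h x"
    and h2: "AE x in lborel. (\<forall>k. norm (indicator ?K x *\<^sub>R gg k x - indicator ?K x *\<^sub>R ?g x) \<le> h x)
      \<and> (\<lambda>k. indicator ?K x *\<^sub>R gg k x) \<longlonglongrightarrow> indicator ?K x *\<^sub>R ?g x"
  proof (rule L1_fast_convergence[where s="\<lambda>k x. indicator ?K x *\<^sub>R gg k x" and f="\<lambda>x. indicator ?K x *\<^sub>R ?g x" and M=lborel])
    show "(\<integral>\<^sup>+ x. ennreal (norm (indicator ?K x *\<^sub>R gg k x - indicator ?K x *\<^sub>R ?g x)) \<partial>lborel) \<le> ennreal ((1/2)^k)" for k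
      using L2[of k] unfolding gg_def
      by (rule order_trans[rotated]) (auto intro!: nn_integral_mono simp: indicator_def)
  qed (use that in auto)
  have D0: "D \<ge> 0" using D[of 0] norm_ge_zero order_trans by blast
  \<comment> \<open>The first summand comes from |V| \<le> \<mu> (1 + |G|^p) and the bound on the
    gradient of \<eta>, the second from |V| |GG k| \<le> \<mu> (2 |G|^p + h).\<close>
  define w where "w x = (2 * m powr (1 - p) * D * \<mu>) * (indicator ?K x *\<^sub>R ?g x + indicator ?K x)
    + ((p - 1) * m powr (- p) * \<mu>) * (2 * (indicator ?K x *\<^sub>R ?g x) + h x)" for x
  have w: "integrable lborel w"
    unfolding w_def
    using h(1) Gp emeasure_lborel_cball_finite[of "0::real^'n" R]
    by (intro Bochner_Integration.integrable_add integrable_mult_right)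
      (auto simp: loc_integrable_def set_integrable_def integrable_indicator_iff)
  have bound: "AE x in lborel. \<forall>k. norm (F' k x) \<le> w x"
    using VG h2
  proof eventually_elim
    case (elim x)
    show ?case
    proof
      fix k
      show "norm (F' k x) \<le> w x"
      proof (cases "x \<in> ?K")
        case False
        then have "norm x > R" by simp
        then have "F' k x = 0"
          using \<eta>(4) gradient_vanishes[of R \<eta>, OF \<eta>(4)] by (simp add: F'_def)
        then show ?thesis using False h(2) D0 \<mu> p by (simp add: w_def)
      next
        case True
        have mle: "U k x powr s \<le> m powr s" if "s \<le> 0" for s
          using that mU[of x k] True m(1) by (intro powr_mono2') auto
        have V1: "norm (V x) \<le> \<mu> * (1 + ?g x)"
        proof -
          have "norm (G x) powr (p - 1) * 1 \<le> ?g x + 1 powr p"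
            by (rule powr_pred_mult_le) (use p in auto)
          then show ?thesis
            using elim(1) \<mu> by (smt (verit) mult_left_mono powr_one_eq_one mult_1_right)
        qed
        have V2: "norm (V x) * norm (GG k x) \<le> \<mu> * (2 * ?g x + h x)"
        proof -
          have "norm (V x) * norm (GG k x) \<le> \<mu> * norm (G x) powr (p - 1) * norm (GG k x)"
            using elim(1) by (intro mult_right_mono) auto
          also have "\<dots> \<le> \<mu> * (?g x + gg k x)"
            using mollify_young[OF G Gp \<rho> p, of "norm (G x)" k x] \<mu>
            by (simp add: GG_def gg_def mult.assoc)
          also have "gg k x \<le> ?g x + h x"
            using elim(2) True by (simp add: abs_le_iff) (smt (verit))
          finally show ?thesis using \<mu> by (simp add: algebra_simps)
        qed
        have "norm (F' k x) \<le> norm (V x \<bullet> ((2 * \<eta> x * U k x powr (1 - p)) *\<^sub>R gradient \<eta> x))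
          + norm (V x \<bullet> (((1 - p) * (\<eta> x)\<^sup>2 * U k x powr (- p)) *\<^sub>R GG k x))"
          unfolding F'_def inner_add_right by (rule norm_triangle_ineq)
        also have "\<dots> \<le> norm (V x) * (2 * \<eta> x * U k x powr (1 - p) * norm (gradient \<eta> x))
           + norm (V x) * ((p - 1) * (\<eta> x)\<^sup>2 * U k x powr (- p) * norm (GG k x))"
          using \<eta>(2)[of x] p
          by (intro add_mono order_trans[OF Cauchy_Schwarz_ineq2[unfolded real_norm_def[symmetric]]])
            (auto simp: abs_mult)
        also have "norm (V x) * (2 * \<eta> x * U k x powr (1 - p) * norm (gradient \<eta> x))
           \<le> (\<mu> * (1 + ?g x)) * (2 * 1 * m powr (1 - p) * D)"
          using V1 \<eta>(2,3)[of x] mle[of "1 - p"] p D[of x] \<mu> m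
          by (intro mult_mono) auto
        also have "norm (V x) * ((p - 1) * (\<eta> x)\<^sup>2 * U k x powr (- p) * norm (GG k x))
          = ((p - 1) * (\<eta> x)\<^sup>2 * U k x powr (- p)) * (norm (V x) * norm (GG k x))"
          by simp
        also have "\<dots> \<le> ((p - 1) * 1 * m powr (- p)) * (\<mu> * (2 * ?g x + h x))"
          using \<eta>(2,3)[of x] mle[of "- p"] p h(2)[of x] \<mu>
          by (intro mult_mono[OF mult_mono[OF mult_mono] V2]) (auto simp: power_le_one)
        finally show ?thesis using True by (simp add: w_def algebra_simps)
      qed
    qed
  qed
  have lim: "AE x in lborel. (\<lambda>k. F' k x) \<longlonglongrightarrow> F x"
    using h1
  proof eventually_elim
    case (elim x)
    show ?case
    proof (cases "x \<in> ?K")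
      case False
      then have "norm x > R" by simp
      then show ?thesis
        using \<eta>(4) gradient_vanishes[of R \<eta>, OF \<eta>(4)] by (simp add: F'_def F_def)
    next
      case True
      then have "(\<lambda>k. GG k x) \<longlonglongrightarrow> G x" using elim by simp
      then show ?thesis
        unfolding F'_def F_def using u(2)[of x]
        by (intro tendsto_intros Ulim) auto
    qed
  qed
  have ms: "F \<in> borel_measurable lborel" "\<And>k. F' k \<in> borel_measurable lborel" by auto
  have bound': "\<And>k. AE x in lborel. norm (F' k x) \<le> w x" using bound by (auto elim: eventually_mono)
  show "integrable lborel F"
    by (rule integrable_dominated_convergence[OF ms w lim bound'])
  have "(\<lambda>k. integral\<^sup>L lborel (F' k)) \<longlonglongrightarrow> integral\<^sup>L lborel F"
    by (rule integral_dominated_convergence[OF ms w lim bound'])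
  then show "0 \<le> integral\<^sup>L lborel F"
    by (rule LIMSEQ_le_const) (use nonneg in auto)
qed

text \<open>With y = |G|/u the cutoff term of \<open>F\<close> is at most 2 \<mu> \<eta> y^(p-1) D.
  The constant \<delta> is chosen so that Young's inequality absorbs it into half of the coercive
  term (p-1) \<mu>1 \<eta>^2 y^p.\<close>

lemma log_energy_cutoff:
  fixes \<eta> :: "real^'n \<Rightarrow> real"
  assumes p2: "p \<le> 2"
    and \<eta>: "\<And>k. k_smooth k \<eta>" "\<And>x. 0 \<le> \<eta> x" "\<And>x. \<eta> x \<le> 1" "\<And>x. norm x > R \<Longrightarrow> \<eta> x = 0"
    and D: "\<And>x. norm (gradient \<eta> x) \<le> D"
  defines "\<delta> \<equiv> (p - 1) * \<mu>1 / (4 * \<mu>)"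
  shows "integrable lborel (\<lambda>x. (\<eta> x)\<^sup>2 * (u x powr (- p) * norm (G x) powr p))" (is "integrable _ ?w")
    and "(\<integral>x. (\<eta> x)\<^sup>2 * (u x powr (- p) * norm (G x) powr p) \<partial>lborel)
      \<le> \<delta> powr (- p) * D powr p * measure lborel (cball (0::real^'n) R)"
proof -
  define F where "F x = V x \<bullet> ((2 * \<eta> x * u x powr (1 - p)) *\<^sub>R gradient \<eta> x
    + ((1 - p) * (\<eta> x)\<^sup>2 * u x powr (- p)) *\<^sub>R G x)" for x
  have F: "integrable lborel F" "0 \<le> integral\<^sup>L lborel F"
    unfolding F_def[abs_def] by (rule weighted_gradient_test[OF \<eta> D]; assumption)+
  let ?K = "cball (0::real^'n) R"
  have Ki: "integrable lborel (indicat_real ?K)"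
    using emeasure_lborel_cball_finite[of "0::real^'n" R] by (simp add: integrable_indicator_iff)
  have [measurable]: "u \<in> borel_measurable borel" "G \<in> borel_measurable borel" "\<eta> \<in> borel_measurable borel"
    using u(1) G k_smooth_continuous[OF \<eta>(1)] by (auto simp: loc_integrable_def intro: borel_measurable_continuous_onI)
  have D0: "D \<ge> 0" using D[of 0] norm_ge_zero order_trans by blast
  have \<delta>: "\<delta> > 0" using p \<mu> \<mu>1 by (simp add: \<delta>_def)
  define c where "c = (p - 1) * \<mu>1 / 2"
  have c: "c > 0" "c = 2 * \<mu> * \<delta>" using p \<mu>1 \<mu> by (auto simp: c_def \<delta>_def)
  define B where "B = 2 * \<mu> * \<delta> powr (1 - p) * D powr p"
  have B0: "B \<ge> 0" using \<mu> by (simp add: B_def)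
  have key: "AE x in lborel. F x \<le> B * indicator ?K x - c * ?w x"
    using VG coercive
  proof eventually_elim
    case (elim x)
    show ?case
    proof (cases "x \<in> ?K")
      case False
      then have "norm x > R" by simp
      then show ?thesis
        using \<eta>(4) gradient_vanishes[of R \<eta>, OF \<eta>(4)] by (simp add: F_def)
    next
      case True
      define y where "y = norm (G x) / u x"
      have ux: "u x > 0" by (rule u)
      have y0: "y \<ge> 0" using ux by (simp add: y_def)
      have yp: "u x powr (- s) * norm (G x) powr s = y powr s" for s
        using ux by (simp add: y_def powr_divide powr_minus field_simps)
      \<comment> \<open>Young's inequality by cases: either D \<le> \<delta> \<eta> y and
        \<open>D\<close> is replaced by this bound, or \<eta> y < D/\<delta>. The second case uses
        \<eta> \<le> \<eta>^(p-1).\<close>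
      have *: "\<eta> x * y powr (p - 1) * D \<le> \<delta> * ((\<eta> x)\<^sup>2 * y powr p) + \<delta> powr (1 - p) * D powr p"
      proof (cases "D \<le> \<delta> * \<eta> x * y")
        case True
        have "\<eta> x * y powr (p - 1) * D \<le> \<eta> x * y powr (p - 1) * (\<delta> * \<eta> x * y)"
          using True \<eta>(2)[of x] by (intro mult_left_mono) auto
        also have "\<dots> = \<delta> * ((\<eta> x)\<^sup>2 * y powr p)"
          using powr_add[of y "p - 1" 1] y0 by (simp add: power2_eq_square mult_ac)
        finally show ?thesis by (smt (verit) mult_nonneg_nonneg powr_ge_zero)
      next
        case False
        then have lt: "\<eta> x * y < D / \<delta>" using \<delta> by (simp add: field_simps)
        then have Dp: "D > 0" using \<delta> \<eta>(2)[of x] y0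
          by (smt (verit) divide_nonpos_pos mult_nonneg_nonneg)
        have "\<eta> x * y powr (p - 1) \<le> \<eta> x powr (p - 1) * y powr (p - 1)"
        proof (cases "\<eta> x = 0")
          case False
          then have "\<eta> x > 0" using \<eta>(2)[of x] by simp
          then have "\<eta> x powr 1 \<le> \<eta> x powr (p - 1)"
            using \<eta>(3)[of x] p2 by (intro powr_mono') auto
          then show ?thesis using \<open>\<eta> x > 0\<close> by (intro mult_right_mono) auto
        qed simp
        also have "\<dots> = (\<eta> x * y) powr (p - 1)"
          using \<eta>(2)[of x] y0 by (simp add: powr_mult)
        also have "\<dots> \<le> (D / \<delta>) powr (p - 1)"
          using lt \<eta>(2)[of x] y0 p by (intro powr_mono2) auto
        finally have "\<eta> x * y powr (p - 1) * D \<le> (D / \<delta>) powr (p - 1) * D"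
          using D0 by (intro mult_right_mono)
        also have "\<dots> = \<delta> powr (1 - p) * D powr p"
          using Dp \<delta> powr_add[of D "p - 1" 1] powr_minus[of \<delta> "p - 1"]
          by (simp add: powr_divide) (simp add: field_simps)
        finally show ?thesis
          using \<delta> by (smt (verit) mult_nonneg_nonneg powr_ge_zero zero_le_power2)
      qed
      have "(2 * \<eta> x * u x powr (1 - p)) * (V x \<bullet> gradient \<eta> x)
          \<le> (2 * \<eta> x * u x powr (1 - p)) * (\<mu> * norm (G x) powr (p - 1) * D)"
      proof (intro mult_left_mono)
        have "V x \<bullet> gradient \<eta> x \<le> norm (V x) * norm (gradient \<eta> x)" by (rule norm_cauchy_schwarz)
        also have "\<dots> \<le> \<mu> * norm (G x) powr (p - 1) * D"
          using elim(1) D \<mu> by (intro mult_mono) auto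
        finally show "V x \<bullet> gradient \<eta> x \<le> \<mu> * norm (G x) powr (p - 1) * D" .
      qed (use \<eta>(2)[of x] in auto)
      also have "\<dots> = 2 * \<mu> * (\<eta> x * y powr (p - 1) * D)"
        using yp[of "p - 1"] by (simp add: mult_ac)
      also have "\<dots> \<le> 2 * \<mu> * (\<delta> * ((\<eta> x)\<^sup>2 * y powr p) + \<delta> powr (1 - p) * D powr p)"
        using * \<mu> by (intro mult_left_mono) auto
      also have "\<dots> = c * ?w x + B"
        by (simp add: yp c(2) B_def algebra_simps)
      finally have 1: "(2 * \<eta> x * u x powr (1 - p)) * (V x \<bullet> gradient \<eta> x) \<le> c * ?w x + B" .
      have "2 * c * ?w x = ((p - 1) * (\<eta> x)\<^sup>2 * u x powr (- p)) * (\<mu>1 * norm (G x) powr p)"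
        by (simp add: c_def)
      also have "\<dots> \<le> ((p - 1) * (\<eta> x)\<^sup>2 * u x powr (- p)) * (V x \<bullet> G x)"
        using elim(2) p by (intro mult_left_mono) auto
      finally have 2: "2 * c * ?w x \<le> ((p - 1) * (\<eta> x)\<^sup>2 * u x powr (- p)) * (V x \<bullet> G x)" .
      have "F x = (2 * \<eta> x * u x powr (1 - p)) * (V x \<bullet> gradient \<eta> x)
          - ((p - 1) * (\<eta> x)\<^sup>2 * u x powr (- p)) * (V x \<bullet> G x)"
        by (simp add: F_def inner_add_right algebra_simps)
      then show ?thesis using 1 2 True by simp
    qed
  qed
  have w0: "?w x \<ge> 0" for x by simp
  \<comment> \<open>Integrability also comes from \<open>key\<close>, which bounds \<open>?w\<close>
    by an integrable function.\<close>
  show wi: "integrable lborel ?w"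
  proof (rule Bochner_Integration.integrable_bound)
    show "integrable lborel (\<lambda>x. (B * indicator ?K x - F x) / c)"
      using Ki F(1) by auto
    show "AE x in lborel. norm (?w x) \<le> norm ((B * indicator ?K x - F x) / c)"
      using key
    proof eventually_elim
      case (elim x)
      then have "?w x \<le> (B * indicator ?K x - F x) / c"
        using c(1) by (simp add: field_simps)
      then show ?case using w0[of x] by (simp only: real_norm_def)
    qed
  qed measurable
  have "integral\<^sup>L lborel F \<le> (\<integral>x. B * indicator ?K x - c * ?w x \<partial>lborel)"
    using key by (intro integral_mono_AE F(1) Bochner_Integration.integrable_diff integrable_mult_right Ki wi)
  also have "\<dots> = B * measure lborel ?K - c * integral\<^sup>L lborel ?w"
    by (subst Bochner_Integration.integral_diff[OF integrable_mult_right[OF Ki] integrable_mult_right[OF wi]]) simp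
  finally have "c * integral\<^sup>L lborel ?w \<le> B * measure lborel ?K"
    using F(2) by simp
  then have "integral\<^sup>L lborel ?w \<le> (B / c) * measure lborel ?K"
    using c(1) by (simp add: field_simps)
  also have "B / c = \<delta> powr (- p) * D powr p"
    using \<delta> \<mu> powr_add[of \<delta> "- p" 1] by (simp add: B_def c(2) powr_diff powr_minus field_simps)
  finally show "integral\<^sup>L lborel ?w \<le> \<delta> powr (- p) * D powr p * measure lborel ?K" .
qed

text \<open>Scaling: for a cutoff at radius R the gradient bound contributes R^(-p) and the volume
  of the ball of radius 2R contributes R^n.\<close>

lemma log_energy_growth:
  assumes p2: "p \<le> 2"
  obtains C where "\<And>R. R > 0 \<Longrightarrow> set_integrable lborel (cball 0 R) (\<lambda>x. u x powr (- p) * norm (G x) powr p)"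
    "\<And>R. R > 0 \<Longrightarrow> (LINT x:cball 0 R|lborel. u x powr (- p) * norm (G x) powr p) \<le> C * R powr (CARD('n) - p)"
    "C > 0"
proof -
  obtain \<eta>0 :: "real^'n \<Rightarrow> real" and C0 where \<eta>0: "\<And>k. k_smooth k \<eta>0" "\<And>x. 0 \<le> \<eta>0 x" "\<And>x. \<eta>0 x \<le> 1"
    "\<And>x. norm x \<le> 1 \<Longrightarrow> \<eta>0 x = 1" "\<And>x. norm x > 2 \<Longrightarrow> \<eta>0 x = 0"
    and C0: "C0 > 0" "\<And>x. norm (gradient \<eta>0 x) \<le> C0"
    by (rule cutoff_exists) blast
  let ?w = "\<lambda>x. u x powr (- p) * norm (G x) powr p"
  have [measurable]: "u \<in> borel_measurable borel" "G \<in> borel_measurable borel"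
    using u(1) G by (auto simp: loc_integrable_def intro: borel_measurable_continuous_onI)
  define \<delta> where "\<delta> = (p - 1) * \<mu>1 / (4 * \<mu>)"
  have \<delta>: "\<delta> > 0" using p \<mu> \<mu>1 by (simp add: \<delta>_def)
  define v where "v = unit_ball_vol (real DIM(real^'n))"
  have v: "v > 0" by (simp add: v_def)
  define C where "C = \<delta> powr (- p) * C0 powr p * (v * 2 ^ CARD('n))"
  have *: "set_integrable lborel (cball 0 R) ?w \<and>
      (LINT x:cball 0 R|lborel. ?w x) \<le> C * R powr (CARD('n) - p)" if R: "R > 0" for R
  proof -
    define \<eta> where "\<eta> x = \<eta>0 ((1/R) *\<^sub>R x)" for x
    have \<eta>1: "k_smooth k \<eta>" for k
      unfolding \<eta>_def using k_smooth_affine[OF \<eta>0(1), of k 0 "1/R"] by simp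
    have \<eta>2: "0 \<le> \<eta> x" "\<eta> x \<le> 1" for x using \<eta>0 by (auto simp: \<eta>_def)
    have \<eta>3: "\<eta> x = 0" if "norm x > 2 * R" for x
      unfolding \<eta>_def by (rule \<eta>0(5)) (use that R in \<open>simp add: field_simps\<close>)
    have \<eta>4: "\<eta> x = 1" if "norm x \<le> R" for x
      unfolding \<eta>_def by (rule \<eta>0(4)) (use that R in \<open>simp add: field_simps\<close>)
    have D: "norm (gradient \<eta> x) \<le> C0 / R" for x
      unfolding \<eta>_def using gradient_affine[OF \<eta>0(1), of 0 "1/R" x] C0(2)[of "(1/R) *\<^sub>R x"] R
      by (simp add: divide_right_mono)
    note E = log_energy_cutoff[OF p2 \<eta>1 \<eta>2 \<eta>3 D, folded \<delta>_def]
    have le: "indicator (cball 0 R) x *\<^sub>R ?w x \<le> (\<eta> x)\<^sup>2 * ?w x" for x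
      using \<eta>4[of x] by (auto simp: indicator_def)
    have i: "set_integrable lborel (cball 0 R) ?w"
      unfolding set_integrable_def
      by (rule Bochner_Integration.integrable_bound[OF E(1)]) (use le in \<open>auto simp: indicator_def\<close>)
    then have "(LINT x:cball 0 R|lborel. ?w x) \<le> (\<integral>x. (\<eta> x)\<^sup>2 * ?w x \<partial>lborel)"
      unfolding set_lebesgue_integral_def using E(1) le by (intro integral_mono) (auto simp: set_integrable_def)
    also have "\<dots> \<le> \<delta> powr (- p) * (C0 / R) powr p * measure lborel (cball (0::real^'n) (2 * R))"
      by (rule E(2))
    also have "measure lborel (cball (0::real^'n) (2 * R)) = v * 2 ^ CARD('n) * R powr CARD('n)"
      using R by (simp add: content_cball v_def power_mult_distrib powr_realpow)
    also have "\<delta> powr (- p) * (C0 / R) powr p * (v * 2 ^ CARD('n) * R powr CARD('n)) = C * R powr (CARD('n) - p)"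
      using R C0 by (simp add: C_def powr_divide powr_diff)
    finally show ?thesis using i by simp
  qed
  show thesis
    by (rule that[of C]) (use * C0 \<delta> v in \<open>auto simp: C_def\<close>)
qed

text \<open>Up to powers of R and t, |G|^(p-1) is the \<alpha>-th power of the product of the energy
  density and u^p, because the powers of \<open>u\<close> cancel. Both factors have controlled
  integrals, which keeps the flux through a distant shell below \<open>c0\<close>.\<close>

lemma no_global_flux:
  assumes p2: "p \<le> 2" and n: "real CARD('n) \<le> p\<^sup>2"
    and up: "integrable lborel (\<lambda>x. u x powr p)"
    and c0: "c0 > 0"
    and flux: "\<And>\<zeta>. \<zeta> \<in> test_functions \<Longrightarrow> (\<And>x. 0 \<le> \<zeta> x) \<Longrightarrow> (\<And>x. norm x \<le> 1 \<Longrightarrow> \<zeta> x = 1) \<Longrightarrow>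
      c0 \<le> (\<integral>x. V x \<bullet> gradient \<zeta> x \<partial>lborel)"
  shows False
proof -
  let ?n = "real CARD('n)"
  let ?w = "\<lambda>x. u x powr (- p) * norm (G x) powr p"
  obtain C where Ci: "\<And>R. R > 0 \<Longrightarrow> set_integrable lborel (cball 0 R) ?w"
    and Cb: "\<And>R. R > 0 \<Longrightarrow> (LINT x:cball 0 R|lborel. ?w x) \<le> C * R powr (?n - p)"
    and C: "C > 0"
    by (rule log_energy_growth[OF p2]) blast
  obtain \<eta>0 :: "real^'n \<Rightarrow> real" and C0 where \<eta>0: "\<And>k. k_smooth k \<eta>0" "\<And>x. 0 \<le> \<eta>0 x"
    "\<And>x. norm x \<le> 1 \<Longrightarrow> \<eta>0 x = 1" "\<And>x. norm x > 2 \<Longrightarrow> \<eta>0 x = 0"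
    and C0: "C0 > 0" "\<And>x. norm (gradient \<eta>0 x) \<le> C0"
    "\<And>x. norm x < 1 \<or> norm x > 2 \<Longrightarrow> gradient \<eta>0 x = 0"
    by (rule cutoff_exists) blast
  have [measurable]: "u \<in> borel_measurable borel" "G \<in> borel_measurable borel"
    using u(1) G by (auto simp: loc_integrable_def intro: borel_measurable_continuous_onI)
  define \<alpha> where "\<alpha> = (p - 1) / p"
  have \<alpha>: "\<alpha> > 0" "2 * \<alpha> \<le> 1" "p * \<alpha> = p - 1" using p p2 by (auto simp: \<alpha>_def field_simps)
  define v where "v = measure lborel (cball (0::real^'n) 1)"
  define C1 where "C1 = C * 2 powr (?n - p) + v * 2 powr ?n"
  have C1: "C1 > 0"
    unfolding C1_def v_def using C by (intro add_pos_nonneg mult_pos_pos mult_nonneg_nonneg) auto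
  define \<epsilon> where "\<epsilon> k = (\<integral>x. indicator {x. norm x \<ge> real k} x *\<^sub>R u x powr p \<partial>lborel)" for k :: nat
  have \<epsilon>i: "integrable lborel (\<lambda>x. indicator {x. norm x \<ge> real k} x *\<^sub>R u x powr p)" for k
    by (rule Bochner_Integration.integrable_bound[OF up]) (auto simp: indicator_def)
  have \<epsilon>0: "\<epsilon> \<longlonglongrightarrow> 0"
  proof -
    have "\<epsilon> \<longlonglongrightarrow> (\<integral>x. 0 \<partial>(lborel :: (real^'n) measure))"
      unfolding \<epsilon>_def
    proof (rule integral_dominated_convergence[where w="\<lambda>x. u x powr p"])
      show "AE x in lborel. (\<lambda>k. indicator {x. norm x \<ge> real k} x *\<^sub>R u x powr p) \<longlonglongrightarrow> 0"
      proof (intro AE_I2 tendsto_eventually)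
        fix x :: "real^'n"
        obtain N where "norm x < real N" using reals_Archimedean2 by blast
        then show "\<forall>\<^sub>F k in sequentially. indicator {x. norm x \<ge> real k} x *\<^sub>R u x powr p = 0"
          by (intro eventually_mono[OF eventually_ge_at_top[of N]]) (auto simp: indicator_def)
      qed
    qed (use up in \<open>auto simp: indicator_def\<close>)
    then show ?thesis by simp
  qed
  \<comment> \<open>Young's inequality with third factor 1, using \<open>2 * \<alpha> \<le> 1\<close>.\<close>
  have young: "(x * y) powr \<alpha> \<le> x + y + 1" if "x \<ge> 0" "y \<ge> 0" for x y :: real
  proof -
    define M where "M = max 1 (max x y)"
    have "x * y \<le> M * M" using that by (intro mult_mono) (auto simp: M_def)
    then have "(x * y) powr \<alpha> \<le> (M * M) powr \<alpha>"
      using that \<alpha> by (intro powr_mono2) auto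
    also have "\<dots> = M powr (2 * \<alpha>)"
      by (simp add: powr_mult flip: powr_add)
    also have "\<dots> \<le> M powr 1" using \<alpha> by (intro powr_mono) (auto simp: M_def)
    also have "\<dots> \<le> x + y + 1" using that by (auto simp: M_def)
    finally show ?thesis .
  qed
  have main: "c0 * t powr \<alpha> \<le> \<mu> * C0 * (C1 + t * \<epsilon> k)" if t: "t > 0" and k: "k \<ge> 1" for t k
  proof -
    define R where "R = real k"
    have R: "R \<ge> 1" using k by (simp add: R_def)
    define \<eta> where "\<eta> x = \<eta>0 ((1/R) *\<^sub>R x)" for x
    have "\<eta> \<in> test_functions"
      unfolding \<eta>_def
    proof (rule test_functionsI[where c=0 and r="2*R"])
      show "k_smooth k (\<lambda>x. \<eta>0 ((1/R) *\<^sub>R x))" for k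
        using k_smooth_affine[OF \<eta>0(1), of k 0 "1/R"] by simp
      show "\<eta>0 ((1/R) *\<^sub>R x) = 0" if "norm (x - 0) > 2 * R" for x
        by (rule \<eta>0(4)) (use that R in \<open>simp add: field_simps\<close>)
    qed
    moreover have "0 \<le> \<eta> x" for x using \<eta>0 by (simp add: \<eta>_def)
    moreover have "\<eta> x = 1" if "norm x \<le> 1" for x
      unfolding \<eta>_def by (rule \<eta>0(3)) (use that R in \<open>simp add: field_simps\<close>)
    ultimately have fl: "c0 \<le> (\<integral>x. V x \<bullet> gradient \<eta> x \<partial>lborel)" using flux by blast
    have g: "gradient \<eta> x = (1/R) *\<^sub>R gradient \<eta>0 ((1/R) *\<^sub>R x)" for x
      unfolding \<eta>_def using gradient_affine[OF \<eta>0(1), of 0 "1/R" x] by simp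
    have D: "norm (gradient \<eta> x) \<le> C0 / R" for x
      using C0(2)[of "(1/R) *\<^sub>R x"] R by (simp add: g divide_right_mono)
    have D0: "gradient \<eta> x = 0" if "norm x < R \<or> norm x > 2 * R" for x
      unfolding g using that R by (subst C0(3)) (auto simp: field_simps)
    \<comment> \<open>Balanced so that the integral is of order R^n: the energy grows like R^(n-p),
      the tail of u^p receives the weight t R^n, and the last summand is the volume.\<close>
    define Q where "Q x = R powr p * (indicator (cball 0 (2*R)) x *\<^sub>R ?w x)
      + t * R powr ?n * (indicator {x. norm x \<ge> real k} x *\<^sub>R u x powr p) + indicator (cball 0 (2*R)) x" for x
    have Ki: "integrable lborel (indicat_real (cball (0::real^'n) (2*R)))"
      using emeasure_lborel_cball_finite[of "0::real^'n" "2*R"] by (simp add: integrable_indicator_iff)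
    have wi: "integrable lborel (\<lambda>x. indicator (cball 0 (2*R)) x *\<^sub>R ?w x)"
      using Ci[of "2*R"] R by (simp add: set_integrable_def)
    have Qi: "integrable lborel Q"
      unfolding Q_def by (intro Bochner_Integration.integrable_add integrable_mult_right wi \<epsilon>i Ki)
    have Q0: "Q x \<ge> 0" for x using t by (simp add: Q_def)
    have "integral\<^sup>L lborel Q = R powr p * (LINT x:cball 0 (2*R)|lborel. ?w x) + t * R powr ?n * \<epsilon> k
        + measure lborel (cball (0::real^'n) (2*R))"
    proof -
      have "integral\<^sup>L lborel Q = (\<integral>x. R powr p * (indicator (cball 0 (2*R)) x *\<^sub>R ?w x) \<partial>lborel)
        + (\<integral>x. t * R powr ?n * (indicator {x. norm x \<ge> real k} x *\<^sub>R u x powr p) \<partial>lborel)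
        + integral\<^sup>L lborel (indicat_real (cball (0::real^'n) (2*R)))"
        unfolding Q_def
        by (simp only: Bochner_Integration.integral_add[OF Bochner_Integration.integrable_add
            [OF integrable_mult_right[OF wi] integrable_mult_right[OF \<epsilon>i]] Ki]
            Bochner_Integration.integral_add[OF integrable_mult_right[OF wi] integrable_mult_right[OF \<epsilon>i]])
      then show ?thesis
        by (simp only: integral_mult_right_zero) (simp add: \<epsilon>_def set_lebesgue_integral_def)
    qed
    also have "\<dots> \<le> R powr p * (C * (2*R) powr (?n - p)) + t * R powr ?n * \<epsilon> k + v * 2 powr ?n * R powr ?n"
      using Cb[of "2*R"] R t
      by (intro add_mono mult_left_mono) (auto simp: content_cball v_def power_mult_distrib powr_realpow)
    also have "\<dots> = R powr ?n * (C1 + t * \<epsilon> k)"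
      using R powr_add[of R p "?n - p"] by (simp add: C1_def powr_mult algebra_simps)
    finally have Qb: "integral\<^sup>L lborel Q \<le> R powr ?n * (C1 + t * \<epsilon> k)" .
    \<comment> \<open>The factor that accompanies |G|^(p-1) in the \<alpha>-th power of the product
      of the first two summands of \<open>Q\<close>.\<close>
    define H where "H = t powr \<alpha> * R powr ((p + ?n) * \<alpha>)"
    have H: "H > 0" using t R by (simp add: H_def)
    define L where "L = \<mu> * C0 / (R * H)"
    have L: "L > 0" using \<mu> C0 R H by (simp add: L_def)
    have "AE x in lborel. V x \<bullet> gradient \<eta> x \<le> L * Q x"
      using VG
    proof eventually_elim
      case (elim x)
      show ?case
      proof (cases "norm x < R \<or> norm x > 2 * R")
        case True
        then show ?thesis using D0[of x] L Q0[of x] by simp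
      next
        case False
        have "H * norm (G x) powr (p - 1) = ((R powr p * ?w x) * (t * R powr ?n * u x powr p)) powr \<alpha>"
        proof -
          have "(R powr p * ?w x) * (t * R powr ?n * u x powr p) = t * R powr (p + ?n) * norm (G x) powr p"
            using u(2)[of x] by (simp add: powr_add powr_minus field_simps)
          also have "(t * R powr (p + ?n) * norm (G x) powr p) powr \<alpha> = H * norm (G x) powr (p * \<alpha>)"
            using t R by (simp add: H_def powr_mult powr_powr)
          finally show ?thesis by (simp add: \<alpha>(3))
        qed
        also have "\<dots> \<le> R powr p * ?w x + t * R powr ?n * u x powr p + 1"
          using t by (intro young) auto
        also have "\<dots> = Q x" using False by (simp add: Q_def R_def)
        finally have "norm (G x) powr (p - 1) \<le> Q x / H"
          using H by (simp add: field_simps)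
        then have VQ: "norm (V x) \<le> \<mu> * (Q x / H)"
          using elim \<mu> by (smt (verit) mult_left_mono)
        have "V x \<bullet> gradient \<eta> x \<le> norm (V x) * norm (gradient \<eta> x)" by (rule norm_cauchy_schwarz)
        also have "\<dots> \<le> \<mu> * (Q x / H) * (C0 / R)"
          using VQ D[of x] \<mu> Q0[of x] H by (intro mult_mono) auto
        finally show ?thesis by (simp add: L_def field_simps)
      qed
    qed
    \<comment> \<open>A non-integrable function has integral 0, which \<open>fl\<close>
      excludes.\<close>
    moreover have "integrable lborel (\<lambda>x. V x \<bullet> gradient \<eta> x)"
      using fl c0 not_integrable_integral_eq by fastforce
    ultimately have "(\<integral>x. V x \<bullet> gradient \<eta> x \<partial>lborel) \<le> (\<integral>x. L * Q x \<partial>lborel)"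
      by (intro integral_mono_AE integrable_mult_right Qi)
    also have "\<dots> \<le> L * (R powr ?n * (C1 + t * \<epsilon> k))"
      using Qb L by simp
    finally have "c0 \<le> L * (R powr ?n * (C1 + t * \<epsilon> k))" using fl by simp
    then have "c0 * t powr \<alpha> \<le> \<mu> * C0 * (C1 + t * \<epsilon> k) * (R powr ?n / (R * R powr ((p + ?n) * \<alpha>)))"
      using t R by (simp add: L_def H_def field_simps)
    also have "R powr ?n / (R * R powr ((p + ?n) * \<alpha>)) = R powr (?n - (1 + (p + ?n) * \<alpha>))"
      using R by (simp add: powr_diff powr_add)
    also have "\<mu> * C0 * (C1 + t * \<epsilon> k) * R powr (?n - (1 + (p + ?n) * \<alpha>)) \<le> \<mu> * C0 * (C1 + t * \<epsilon> k) * 1"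
    proof (intro mult_left_mono)
      have "?n - (1 + (p + ?n) * \<alpha>) = (?n - p\<^sup>2) / p"
        using p by (simp add: \<alpha>_def power2_eq_square field_simps)
      also have "\<dots> \<le> 0" using n p by (simp add: divide_nonpos_pos)
      finally have "R powr (?n - (1 + (p + ?n) * \<alpha>)) \<le> R powr 0"
        using R by (intro powr_mono) auto
      then show "R powr (?n - (1 + (p + ?n) * \<alpha>)) \<le> 1" using R by simp
      have "\<epsilon> k \<ge> 0" unfolding \<epsilon>_def by (rule integral_nonneg_AE) auto
      then show "0 \<le> \<mu> * C0 * (C1 + t * \<epsilon> k)" using \<mu> C0 C1 t by simp
    qed
    finally show ?thesis by simp
  qed
  have lim: "c0 * t powr \<alpha> \<le> \<mu> * C0 * C1" if t: "t > 0" for t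
  proof -
    have "(\<lambda>k. \<mu> * C0 * (C1 + t * \<epsilon> k)) \<longlonglongrightarrow> \<mu> * C0 * (C1 + t * 0)"
      by (intro tendsto_intros \<epsilon>0)
    then have "c0 * t powr \<alpha> \<le> \<mu> * C0 * (C1 + t * 0)"
      by (rule LIMSEQ_le_const) (use main[OF t] in blast)
    then show ?thesis by simp
  qed
  \<comment> \<open>Chosen so that \<open>c0 * z\<close> exceeds the bound in \<open>lim\<close> by
    \<open>c0\<close>; it is the value of \<open>t powr \<alpha>\<close> at
    \<open>t = z powr (1 / \<alpha>)\<close>.\<close>
  define z where "z = \<mu> * C0 * C1 / c0 + 1"
  have z: "z > 0" using \<mu> C0 C1 c0 by (simp add: z_def add_pos_pos)
  then have "c0 * z \<le> \<mu> * C0 * C1"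
    using lim[of "z powr (1 / \<alpha>)"] \<alpha>(1) by (simp add: powr_powr)
  moreover have "c0 * z = \<mu> * C0 * C1 + c0"
    using c0 by (simp add: z_def distrib_left)
  ultimately show False using c0 by simp
qed

end

section \<open>The weight and Borel representatives\<close>

text \<open>A dyadic decomposition: summand \<open>k\<close> carries the weight 2^(-a(k+1)) on the
  ball of radius 2^(-k), so the integrals form a geometric series with ratio 2^(-a)/2^n, which is
  less than 1 exactly when -a < n.\<close>

lemma set_integrable_norm_powr:
  fixes a :: real
  assumes "a \<le> 0" "- a < DIM('a::euclidean_space)"
  shows "set_integrable lborel (cball 0 R) (\<lambda>x::'a. norm x powr a)"
proof -
  define c where "c = 2 powr (- a)"
  define n where "n = DIM('a)"
  define v where "v = unit_ball_vol (real n)"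
  have c: "c > 0" by (simp add: c_def)
  have cn: "c < 2 ^ n" using assms(2) by (simp add: c_def n_def powr_less_cancel_iff flip: powr_realpow)
  have v: "v \<ge> 0" by (simp add: v_def)
  have [measurable]: "cball (0::'a) r \<in> sets lborel" for r by simp
  let ?S = "\<lambda>x::'a. (\<Sum>k. ennreal (c * c ^ k) * indicator (cball 0 ((1/2) ^ k)) x)"
  \<comment> \<open>For \<open>2^(-k-1) < |x| \<le> 2^(-k)\<close> the \<open>k\<close>-th summand alone dominates \<open>|x|^a\<close>.\<close>
  have pt: "ennreal (norm x powr a) \<le> ?S x + 1" for x :: 'a
  proof (cases "x = 0 \<or> norm x \<ge> 1")
    \<comment> \<open>The summand 1 covers \<open>norm x \<ge> 1\<close>, and also
      \<open>x = 0\<close>, where \<open>0 powr a\<close> is 0.\<close>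
    case True
    then have "norm x powr a \<le> 1"
      using assms(1) powr_mono[of a 0 "norm x"] by (auto split: if_splits)
    then have "ennreal (norm x powr a) \<le> 1" by (metis ennreal_1 ennreal_leI)
    then show ?thesis by (rule order_trans) simp
  next
    case False
    then have x: "norm x > 0" "norm x < 1" by auto
    obtain j where j: "(1/2) ^ j < norm x" "\<And>i. i < j \<Longrightarrow> \<not> (1/2) ^ i < norm x"
      using exists_least_iff[of "\<lambda>j. (1/2) ^ j < norm x"] real_arch_pow_inv[OF x(1), of "1/2"] by auto
    then obtain k where k: "j = Suc k" using x by (cases j) auto
    have xk: "x \<in> cball 0 ((1/2) ^ k)" using j(2)[of k] k by simp
    have "norm x powr a \<le> ((1/2) ^ Suc k) powr a"
      using j(1) k assms(1) by (intro powr_mono2') auto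
    also have "\<dots> = c * c ^ k"
    proof -
      have "((1/2) ^ Suc k) powr a = (2 powr (- real (Suc k))) powr a"
        by (subst powr_minus, subst powr_realpow) (simp_all add: power_one_over inverse_eq_divide del: power_Suc)
      also have "\<dots> = c powr real (Suc k)" by (simp add: c_def powr_powr algebra_simps)
      also have "\<dots> = c * c ^ k" using c by (subst powr_realpow) auto
      finally show ?thesis .
    qed
    finally have "ennreal (norm x powr a) \<le> ennreal (c * c ^ k) * indicator (cball 0 ((1/2) ^ k)) x"
      using xk by (simp add: ennreal_leI)
    also have "\<dots> \<le> ?S x"
      using sum_le_suminf[of "\<lambda>k. ennreal (c * c ^ k) * indicator (cball 0 ((1/2) ^ k)) x" "{k}"]
      by (simp del: sum_mult_indicator)
    also have "\<dots> \<le> ?S x + 1" by simp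
    finally show ?thesis .
  qed
  have "(\<integral>\<^sup>+x. ?S x \<partial>lborel) = (\<Sum>k. \<integral>\<^sup>+x. ennreal (c * c ^ k) * indicator (cball (0::'a) ((1/2) ^ k)) x \<partial>lborel)"
    by (rule nn_integral_suminf) measurable
  also have "\<dots> = (\<Sum>k. ennreal (c * v * (c / 2 ^ n) ^ k))"
  proof (rule suminf_cong)
    fix k
    have "(\<integral>\<^sup>+x. ennreal (c * c ^ k) * indicator (cball (0::'a) ((1/2) ^ k)) x \<partial>lborel)
      = ennreal (c * c ^ k) * emeasure lborel (cball (0::'a) ((1/2) ^ k))"
      by (simp add: nn_integral_cmult_indicator)
    also have "\<dots> = ennreal (c * c ^ k * (v * ((1/2) ^ k) ^ n))"
      using c v by (simp add: emeasure_cball v_def n_def ennreal_mult)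
    also have "c * c ^ k * (v * ((1/2) ^ k) ^ n) = c * v * (c / 2 ^ n) ^ k"
      by (simp add: power_divide power_mult[symmetric] mult.commute)
    finally show "(\<integral>\<^sup>+x. ennreal (c * c ^ k) * indicator (cball (0::'a) ((1/2) ^ k)) x \<partial>lborel)
      = ennreal (c * v * (c / 2 ^ n) ^ k)" .
  qed
  also have "\<dots> = ennreal (\<Sum>k. c * v * (c / 2 ^ n) ^ k)"
    using c v cn by (intro suminf_ennreal2 summable_mult summable_geometric) auto
  finally have S: "(\<integral>\<^sup>+x. ?S x \<partial>lborel) < \<infinity>" by simp
  show ?thesis
    unfolding set_integrable_def
  proof (rule integrableI_bounded)
    have "(\<integral>\<^sup>+x. norm (indicator (cball 0 R) x *\<^sub>R norm (x::'a) powr a) \<partial>lborel)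
      \<le> (\<integral>\<^sup>+x. ?S x + indicator (cball 0 R) x \<partial>lborel)"
    proof (rule nn_integral_mono)
      fix x :: 'a
      show "ennreal (norm (indicator (cball 0 R) x *\<^sub>R norm x powr a)) \<le> ?S x + indicator (cball 0 R) x"
        using pt[of x] by (auto simp: indicator_def)
    qed
    also have "\<dots> = (\<integral>\<^sup>+x. ?S x \<partial>lborel) + emeasure lborel (cball (0::'a) R)"
      by (simp add: nn_integral_add)
    also have "\<dots> < \<infinity>" using S emeasure_lborel_cball_finite[of "0::'a" R] by simp
    finally show "(\<integral>\<^sup>+x. norm (indicator (cball 0 R) x *\<^sub>R norm (x::'a) powr a) \<partial>lborel) < \<infinity>" .
  qed measurable
qed

lemma borel_representative:
  fixes f :: "'a::euclidean_space \<Rightarrow> 'b::euclidean_space"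
  assumes "f \<in> borel_measurable lebesgue"
  obtains g where "g \<in> borel_measurable borel" "AE x in lborel. f x = g x"
proof -
  have "\<exists>g\<in>borel_measurable lborel. AE x in lborel. f x \<bullet> b = g x" for b
    using assms by (intro completion_ex_borel_measurable_real borel_measurable_inner) auto
  then obtain g where g: "\<And>b. g b \<in> borel_measurable lborel" "\<And>b. AE x in lborel. f x \<bullet> b = g b x"
    by metis
  show thesis
  proof (rule that)
    show "(\<lambda>x. \<Sum>b\<in>Basis. g b x *\<^sub>R b) \<in> borel_measurable borel"
      using g(1) by simp
    have "AE x in lborel. \<forall>b\<in>Basis. f x \<bullet> b = g b x"
      using g(2) by (intro AE_finite_allI) auto
    then show "AE x in lborel. f x = (\<Sum>b\<in>Basis. g b x *\<^sub>R b)"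
    proof eventually_elim
      case (elim x)
      have "f x = (\<Sum>b\<in>Basis. (f x \<bullet> b) *\<^sub>R b)" by (simp add: euclidean_representation)
      also have "\<dots> = (\<Sum>b\<in>Basis. g b x *\<^sub>R b)" using elim by (intro sum.cong) auto
      finally show ?case .
    qed
  qed
qed

text \<open>For a simple function in place of \<open>G\<close> only finitely many \<xi> occur, so
  measurability for each fixed \<xi> suffices. Continuity in \<xi> carries this to the limit outside
  the null set \<open>N\<close>; setting the functions to 0 on \<open>N\<close> makes the
  convergence hold everywhere.\<close>

lemma caratheodory_representative:
  fixes A :: "'a::euclidean_space \<Rightarrow> 'b::euclidean_space \<Rightarrow> 'c::euclidean_space"
  assumes A: "\<And>\<xi>. (\<lambda>x. A x \<xi>) \<in> borel_measurable lebesgue"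
    and cont: "AE x in lebesgue. continuous_on UNIV (A x)"
    and G: "G \<in> borel_measurable borel"
  obtains V where "V \<in> borel_measurable borel" "AE x in lborel. A x (G x) = V x"
proof -
  have "G \<in> borel_measurable lebesgue" using G by (intro measurable_completion) simp
  then obtain s where s: "\<And>i. simple_function lebesgue (s i)" "\<And>x. (\<lambda>i. s i x) \<longlonglongrightarrow> G x"
    using borel_measurable_implies_sequence_metric[of G lebesgue 0] by auto
  obtain N where N: "N \<in> null_sets lebesgue" "\<And>x. x \<notin> N \<Longrightarrow> continuous_on UNIV (A x)"
    using AE_E3[OF cont] by auto
  have NC: "- N \<in> sets lebesgue"
    using N(1) sets.compl_sets[of N lebesgue] by (auto simp: Compl_eq_Diff_UNIV)
  have [measurable]: "(\<lambda>x. A x (s i x)) \<in> borel_measurable lebesgue" for i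
  proof (rule measurable_compose_countable'[where I="range (s i)"])
    show "s i \<in> lebesgue \<rightarrow>\<^sub>M count_space (range (s i))"
      using s(1)[of i] by (auto simp: simple_function_def measurable_count_space_eq2)
    show "countable (range (s i))"
      using s(1)[of i] by (auto simp: simple_function_def countable_finite)
  qed (rule A)
  have "(\<lambda>x. indicator (- N) x *\<^sub>R A x (G x)) \<in> borel_measurable lebesgue"
  proof (rule borel_measurable_LIMSEQ_metric)
    show "(\<lambda>x. indicator (- N) x *\<^sub>R A x (s i x)) \<in> borel_measurable lebesgue" for i
      by (intro borel_measurable_scaleR borel_measurable_indicator NC) measurable
    fix x
    show "(\<lambda>i. indicator (- N) x *\<^sub>R A x (s i x)) \<longlonglongrightarrow> indicator (- N) x *\<^sub>R A x (G x)"
    proof (cases "x \<in> N")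
      case False
      then have "isCont (A x) (G x)" using N(2) by (simp add: continuous_on_eq_continuous_at)
      then have "(\<lambda>i. A x (s i x)) \<longlonglongrightarrow> A x (G x)" by (rule isCont_tendsto_compose) (rule s(2))
      then show ?thesis by (rule tendsto_scaleR[OF tendsto_const])
    qed simp
  qed
  then obtain V where V: "V \<in> borel_measurable borel" "AE x in lborel. indicator (- N) x *\<^sub>R A x (G x) = V x"
    by (rule borel_representative)
  have "AE x in lebesgue. x \<notin> N" using N(1) by (rule AE_not_in)
  then have "AE x in lborel. x \<notin> N" by (simp add: AE_completion_iff)
  with V(2) have "AE x in lborel. A x (G x) = V x"
    by eventually_elim simp
  with V(1) show thesis by (rule that)
qed

text \<open>The integrands in question are identified with a Borel function only almost everywhere,
  so \<open>f\<close> carries no measurability hypothesis; completeness of Lebesgue measure supplies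
  it.\<close>

lemma lebesgue_integral_eq_lborel:
  fixes f g :: "'a::euclidean_space \<Rightarrow> real"
  assumes g: "g \<in> borel_measurable borel" and ae: "AE x in lborel. f x = g x"
  shows "integral\<^sup>L lebesgue f = integral\<^sup>L lborel g"
proof -
  have gl: "g \<in> borel_measurable lebesgue" using g by (intro measurable_completion) simp
  have ael: "AE x in lebesgue. f x = g x" using ae by (rule AE_completion)
  have "f \<in> borel_measurable lebesgue"
  proof (rule measurableI)
    fix S :: "real set" assume "S \<in> sets borel"
    then have "g -` S \<in> sets lebesgue"
      using measurable_sets[OF gl, of S] by simp
    moreover have "AE x in lebesgue. x \<in> g -` S \<longleftrightarrow> x \<in> f -` S"
      using ael by eventually_elim simp
    ultimately show "f -` S \<inter> space lebesgue \<in> sets lebesgue"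
      using completion.in_sets_AE[where A="g -` S" and B="f -` S"] by simp
  qed simp
  then have "integral\<^sup>L lebesgue f = integral\<^sup>L lebesgue g"
    using gl ael by (rule integral_cong_AE)
  also have "\<dots> = integral\<^sup>L lborel g"
    using g by (intro integral_completion) simp
  finally show ?thesis .
qed

lemma Lp_loc_loc_integrable:
  fixes f g :: "'a::euclidean_space \<Rightarrow> 'b::euclidean_space"
  assumes f: "f \<in> Lp_loc s" and g: "g \<in> borel_measurable borel" and ae: "AE x in lborel. f x = g x"
  shows "loc_integrable (\<lambda>x. norm (g x) powr s)"
proof -
  note [measurable] = g
  have "integrable lborel (\<lambda>x. indicator (cball 0 R) x *\<^sub>R norm (g x) powr s)" for R
  proof -
    have [measurable]: "cball (0::'a) R \<in> sets lborel" by simp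
    have i: "integrable lebesgue (\<lambda>x. indicator (cball 0 R) x *\<^sub>R norm (f x) powr s)"
      using f by (auto simp: Lp_loc_def set_integrable_def)
    have m: "(\<lambda>x. indicator (cball 0 R) x *\<^sub>R norm (g x) powr s) \<in> borel_measurable lborel"
      by measurable
    have "integrable lebesgue (\<lambda>x. indicator (cball 0 R) x *\<^sub>R norm (g x) powr s)"
      by (rule integrable_cong_AE_imp[OF i measurable_completion[OF m]])
        (use AE_completion[OF ae] in \<open>auto elim: eventually_mono\<close>)
    then show ?thesis using m by (simp only: integrable_completion)
  qed
  then show ?thesis by (simp add: loc_integrable_def set_integrable_def)
qed

section \<open>Reduction of the theorem to the flux estimate\<close>

theorem mainTheorem4:
  fixes p q a :: real
    and A :: "real^'n::finite \<Rightarrow> real^'n \<Rightarrow> real^'n"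
    and u :: "real^'n \<Rightarrow> real"
  assumes "CARD('n) \<ge> 3"
    and "1 < p" and "p \<le> 2"
    and "q > p - 1"
    and "0 \<le> - a" and "- a < p"
    and "structure_conditions p A"
    and "real CARD('n) \<le> p\<^sup>2"
    and "positive_weak_solution p a q A u"
    and "bounded (range u)"
  shows "u \<notin> Lp p \<and> u \<notin> W1p p"
proof -
  obtain G0 where G0: "G0 \<in> Lp_loc p" "has_weak_gradient u G0"
    and eq: "\<And>\<zeta>. \<zeta> \<in> test_functions \<Longrightarrow>
      (\<integral>x. A x (G0 x) \<bullet> gradient \<zeta> x \<partial>lebesgue) = (\<integral>x. norm x powr a * u x powr q * \<zeta> x \<partial>lebesgue)"
    and u: "continuous_on UNIV u" "\<And>x. u x > 0"
    using assms(9) unfolding positive_weak_solution_def by blast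
  obtain \<mu>1 \<mu>2 where \<mu>: "0 < \<mu>1" "\<mu>1 \<le> \<mu>2"
    and coercive: "AE x in lebesgue. \<forall>\<xi>. A x \<xi> \<bullet> \<xi> \<ge> \<mu>1 * norm \<xi> powr p"
    and growth: "AE x in lebesgue. \<forall>\<xi>. norm (A x \<xi>) \<le> \<mu>2 * norm \<xi> powr (p - 1)"
    using assms(7) unfolding structure_conditions_def eventually_conj_iff by blast
  have G0m: "G0 \<in> borel_measurable lebesgue" using G0(1) by (simp add: Lp_loc_def)
  then obtain G where G: "G \<in> borel_measurable borel" "AE x in lborel. G0 x = G x"
    by (rule borel_representative)
  obtain V where V: "V \<in> borel_measurable borel" "AE x in lborel. A x (G x) = V x"
    using caratheodory_representative[OF _ _ G(1), of A] assms(7) unfolding structure_conditions_def by blast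
  have AV: "AE x in lborel. A x (G0 x) = V x"
    using G(2) V(2) by eventually_elim simp
  note [measurable] = V(1) G(1)
  have [measurable]: "cball (0::real^'n) R \<in> sets lborel" for R by simp
  have [measurable]: "u \<in> borel_measurable borel" using u(1) by (rule borel_measurable_continuous_onI)
  have Lp1: "G0 \<in> Lp_loc 1" using G0(2) by (simp add: has_weak_gradient_def)
  have tm: "\<zeta> \<in> borel_measurable borel" "gradient \<zeta> \<in> borel_measurable borel"
    "partial_deriv i \<zeta> \<in> borel_measurable borel" if "\<zeta> \<in> test_functions" for \<zeta> :: "real^'n \<Rightarrow> real" and i
  proof -
    have k: "k_smooth k \<zeta>" for k using that by (simp add: test_functions_def)
    show "\<zeta> \<in> borel_measurable borel" "gradient \<zeta> \<in> borel_measurable borel"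
      using k_smooth_continuous[OF k] continuous_on_gradient[OF k] by (auto intro: borel_measurable_continuous_onI)
    show "partial_deriv i \<zeta> \<in> borel_measurable borel"
      using k[of "Suc 0"] by (auto intro: borel_measurable_continuous_onI)
  qed
  have flux: "(\<integral>x. V x \<bullet> gradient \<zeta> x \<partial>lborel) = (\<integral>x. norm x powr a * u x powr q * \<zeta> x \<partial>lborel)"
    if \<zeta>: "\<zeta> \<in> test_functions" for \<zeta>
  proof -
    note [measurable] = tm[OF \<zeta>]
    have "(\<integral>x. V x \<bullet> gradient \<zeta> x \<partial>lborel) = (\<integral>x. A x (G0 x) \<bullet> gradient \<zeta> x \<partial>lebesgue)"
      by (rule lebesgue_integral_eq_lborel[symmetric])
        (use AV in \<open>auto elim: eventually_mono\<close>)
    also have "\<dots> = (\<integral>x. norm x powr a * u x powr q * \<zeta> x \<partial>lborel)"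
      unfolding eq[OF \<zeta>] by (rule integral_completion) measurable
    finally show ?thesis .
  qed
  interpret supersolution p \<mu>1 \<mu>2 u G V
  proof
    show "loc_integrable (\<lambda>x. norm (G x) powr p)"
      by (rule Lp_loc_loc_integrable[OF G0(1) G])
    have "loc_integrable (\<lambda>x. norm (G x) powr 1)"
      by (rule Lp_loc_loc_integrable[OF Lp1 G])
    then have "set_integrable lborel (cball 0 R) (\<lambda>x. norm (G x))" for R
      by (simp add: loc_integrable_def)
    then have "integrable lborel (\<lambda>x. norm (indicator (cball 0 R) x *\<^sub>R G x))" for R
      by (simp add: set_integrable_def)
    then have "set_integrable lborel (cball 0 R) G" for R
      unfolding set_integrable_def by (subst (asm) integrable_norm_iff) (auto intro: borel_measurable_scaleR borel_measurable_indicator)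
    then show "loc_integrable G"
      using G(1) by (simp add: loc_integrable_def)
    show "(\<integral>x. u x * partial_deriv i \<zeta> x \<partial>lborel) = - (\<integral>x. G x $ i * \<zeta> x \<partial>lborel)"
      if \<zeta>: "\<zeta> \<in> test_functions" for \<zeta> i
    proof -
      note [measurable] = tm[OF \<zeta>]
      have "(\<integral>x. u x * partial_deriv i \<zeta> x \<partial>lborel) = (\<integral>x. u x * partial_deriv i \<zeta> x \<partial>lebesgue)"
        by (rule integral_completion[symmetric]) measurable
      also have "\<dots> = - (\<integral>x. G0 x $ i * \<zeta> x \<partial>lebesgue)"
        using G0(2) \<zeta> by (simp add: has_weak_gradient_def)
      also have "(\<integral>x. G0 x $ i * \<zeta> x \<partial>lebesgue) = (\<integral>x. G x $ i * \<zeta> x \<partial>lborel)"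
        by (rule lebesgue_integral_eq_lborel)
          (use G(2) in \<open>auto elim: eventually_mono simp: cart_eq_inner_axis\<close>)
      finally show ?thesis .
    qed
    have c: "AE x in lborel. \<forall>\<xi>. A x \<xi> \<bullet> \<xi> \<ge> \<mu>1 * norm \<xi> powr p"
      and g: "AE x in lborel. \<forall>\<xi>. norm (A x \<xi>) \<le> \<mu>2 * norm \<xi> powr (p - 1)"
      using coercive growth by (simp_all only: AE_completion_iff)
    show "AE x in lborel. \<mu>1 * norm (G x) powr p \<le> V x \<bullet> G x"
      using c V(2) by eventually_elim metis
    show "AE x in lborel. norm (V x) \<le> \<mu>2 * norm (G x) powr (p - 1)"
      using g V(2) by eventually_elim metis
    show "0 \<le> (\<integral>x. V x \<bullet> gradient \<zeta> x \<partial>lborel)" if "\<zeta> \<in> test_functions" "\<And>x. 0 \<le> \<zeta> x" for \<zeta>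
      unfolding flux[OF that(1)] using that(2) by (intro integral_nonneg_AE) auto
  qed (use assms u \<mu> V in auto)
  have uq: "continuous_on UNIV (\<lambda>x. u x powr q)"
    using u by (intro continuous_on_powr continuous_on_const) (auto simp: less_imp_neq[symmetric])
  have "\<exists>z\<in>cball (0::real^'n) 1. \<forall>y\<in>cball 0 1. u z powr q \<le> u y powr q"
    by (rule continuous_attains_inf) (auto intro: continuous_on_subset[OF uq])
  then obtain b where b: "b > 0" "\<And>y. norm y \<le> 1 \<Longrightarrow> b \<le> u y powr q"
    using u(2) by (metis mem_cball_0 powr_gt_zero less_irrefl)
  define c0 where "c0 = b * measure lborel (cball (0::real^'n) 1)"
  have c0: "c0 > 0"
    using b content_cball_pos[of 1 "0::real^'n"] by (simp add: c0_def)
  \<comment> \<open>The flux equals the source, and on the unit ball |x|^a is at least 1 because a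
    \<le> 0, while u^q is at least \<open>b\<close>.\<close>
  have mass: "c0 \<le> (\<integral>x. V x \<bullet> gradient \<zeta> x \<partial>lborel)"
    if \<zeta>: "\<zeta> \<in> test_functions" "\<And>x. 0 \<le> \<zeta> x" "\<And>x. norm x \<le> 1 \<Longrightarrow> \<zeta> x = 1" for \<zeta>
  proof -
    note [measurable] = tm[OF \<zeta>(1)]
    have "bounded {x. \<zeta> x \<noteq> 0}"
      using \<zeta>(1) compact_imp_bounded bounded_subset closure_subset by (fastforce simp: test_functions_def)
    then obtain R where R: "\<And>x. \<zeta> x \<noteq> 0 \<Longrightarrow> norm x \<le> R" by (auto simp: bounded_iff)
    have "continuous_on UNIV (\<lambda>x. u x powr q * \<zeta> x)"
      using \<zeta>(1) by (intro continuous_on_mult uq k_smooth_continuous[of 0]) (simp only: test_functions_def mem_Collect_eq)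
    then have "bounded ((\<lambda>x. u x powr q * \<zeta> x) ` cball 0 R)"
      by (intro compact_imp_bounded compact_continuous_image) (auto intro: continuous_on_subset)
    then obtain B where B: "\<And>x. norm x \<le> R \<Longrightarrow> \<bar>u x powr q * \<zeta> x\<bar> \<le> B"
      unfolding bounded_iff by (metis imageI mem_cball_0 real_norm_def)
    \<comment> \<open>The weight is locally integrable since -a < p \<le> 2 < 3 \<le> n. Otherwise
      the source integral could take the default value 0 and give no lower bound.\<close>
    have "integrable lborel (\<lambda>x::real^'n. indicator (cball 0 R) x *\<^sub>R norm x powr a)"
      using set_integrable_norm_powr[of a R, where 'a="real^'n"] assms by (simp add: set_integrable_def)
    from integrable_mult_right[OF this, of B]
    have i: "integrable lborel (\<lambda>x. norm x powr a * u x powr q * \<zeta> x)"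
    proof (rule Bochner_Integration.integrable_bound)
      show "AE x in lborel. norm (norm x powr a * u x powr q * \<zeta> x)
          \<le> norm (B * (indicator (cball 0 R) x *\<^sub>R norm x powr a))"
      proof (rule AE_I2)
        fix x :: "real^'n"
        show "norm (norm x powr a * u x powr q * \<zeta> x) \<le> norm (B * (indicator (cball 0 R) x *\<^sub>R norm x powr a))"
        proof (cases "norm x \<le> R")
          case True
          have "norm (norm x powr a * u x powr q * \<zeta> x) = norm x powr a * \<bar>u x powr q * \<zeta> x\<bar>"
            by (simp add: abs_mult)
          also have "\<dots> \<le> norm x powr a * \<bar>B\<bar>"
            using B[OF True] by (intro mult_left_mono) auto
          finally show ?thesis using True by (simp add: abs_mult mult.commute)
        qed (use R[of x] in auto)
      qed
    qed measurable
    have Ki: "integrable lborel (indicat_real (cball (0::real^'n) 1))"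
      using emeasure_lborel_cball_finite[of "0::real^'n" 1] by (simp add: integrable_indicator_iff)
    have "c0 = (\<integral>x. b * indicator (cball (0::real^'n) 1) x \<partial>lborel)" by (simp add: c0_def)
    also have "\<dots> \<le> (\<integral>x. norm x powr a * u x powr q * \<zeta> x \<partial>lborel)"
    proof (rule integral_mono_AE[OF integrable_mult_right[OF Ki] i])
      show "AE x in lborel. b * indicator (cball 0 1) x \<le> norm x powr a * u x powr q * \<zeta> x"
        \<comment> \<open>At the origin \<open>0 powr a\<close> is 0 and the inequality fails, so
          this point is excluded as a null set.\<close>
        using AE_lborel_singleton[of "0::real^'n"]
      proof eventually_elim
        case (elim x)
        show ?case
        proof (cases "norm x \<le> 1")
          case True
          then have "norm x powr 0 \<le> norm x powr a"
            using elim assms(5) by (intro powr_mono') auto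
          then have "1 * b \<le> norm x powr a * u x powr q"
            using elim b(1) b(2)[OF True] by (intro mult_mono) auto
          then show ?thesis using True \<zeta>(3) by simp
        qed (use \<zeta>(2) in auto)
      qed
    qed
    finally show ?thesis using flux[OF \<zeta>(1)] by simp
  qed
  have "u \<notin> Lp p"
  proof
    assume "u \<in> Lp p"
    then have "integrable lebesgue (\<lambda>x. u x powr p)"
      using u(2) by (simp add: Lp_def less_imp_le)
    then have "integrable lborel (\<lambda>x. u x powr p)"
      by (subst (asm) integrable_completion) auto
    then show False
      using no_global_flux[OF assms(3,8) _ c0 mass] by blast
  qed
  then show ?thesis by (simp add: W1p_def)
qed

end
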